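(* Let $N\ge 2$ and $x\in\mathbb R$, and let $H$ be the integrable spin-one XXZ Hamiltonian on $N$ sites with the diagonal twist. Then $E=0$ is an eigenvalue of $H$ in the subsector where $M\equiv0$ and $F\equiv1$; i.e. there is a non-zero vector $|\phi\rangle\in V$ with $H|\phi\rangle=0$, $M|\phi\rangle=0$ and $F|\phi\rangle=|\phi\rangle$.
   Context: $V=(\mathbb C^3)^{\otimes N}$, with single-site basis $|{\Uparrow}\rangle=(1,0,0)^t$, $|0\rangle=(0,1,0)^t$, $|{\Downarrow}\rangle=(0,0,1)^t$. Spin-one matrices: $s^1=\frac1{\sqrt2}\begin{pmatrix}0&1&0\\1&0&1\\0&1&0\end{pmatrix}$, $s^2=\frac1{\sqrt2}\begin{pmatrix}0&-\mathrm i&0\\ \mathrm i&0&-\mathrm i\\0&\mathrm i&0\end{pmatrix}$, $s^3=\mathrm{diag}(1,0,-1)$; $s^a_j$ is $s^a$ acting on site $j$. The Hamiltonian is $$H=\sum_{j=1}^N\Big(\sum_{a=1}^3J_a\big(s_j^as_{j+1}^a+2(s_j^a)^2\big)-\sum_{a,b=1}^3A_{ab}\,s_j^as_j^bs_{j+1}^as_{j+1}^b\Big),$$ with $J_1=J_2=1$, $J_3=\frac12(x^2-2)$, $A_{ab}=A_{ba}$, $A_{aa}=J_a$, $A_{12}=1$, $A_{13}=A_{23}=x-1$. Diagonal twist: $s^1_{N+1}=-s^1_1$, $s^2_{N+1}=-s^2_1$, $s^3_{N+1}=s^3_1$. The spin-reversal operator is $F=\begin{pmatrix}0&0&1\\0&1&0\\1&0&0\end{pmatrix}^{\otimes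 N}$ and the magnetisation is $M=\sum_{j=1}^Ns_j^3$; both commute with $H$. *)

theory Defs
  imports "HOL-Analysis.Analysis"
begin

text \<open>
  A vector of \<open>(\<complex>\<^sup>3)\<^sup>\<otimes>\<^sup>N\<close> is given by its coordinates in the product basis: a complex function on
  lists \<open>c\<close> of length \<open>N\<close>, where the entry \<open>c ! (j - 1)\<close> is the single-site basis state on site \<open>j\<close>.
  The elements \<open>1\<close>, \<open>2\<close>, \<open>3\<close> of the type \<open>3\<close> label \<open>\<Up>\<close>, \<open>0\<close>, \<open>\<Down>\<close>, in this order (in the type
  \<open>3\<close> one has \<open>3 = 0\<close>).
\<close>

type_synonym state = "3 list \<Rightarrow> complex"

definition tensor_space :: "nat \<Rightarrow> state set" where
  "tensor_space N = {\<psi>. \<forall>c. length c \<noteq> N \<longrightarrow> \<psi> c = 0}"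

text \<open>The operator \<open>A\<close> on site \<open>j\<close> (for \<open>1 \<le> j \<le> N\<close>), the identity on all other sites.\<close>

definition site_op :: "complex^3^3 \<Rightarrow> nat \<Rightarrow> state \<Rightarrow> state" where
  "site_op A j \<psi> = (\<lambda>c. \<Sum>m\<in>UNIV. A $ (c ! (j - 1)) $ m * \<psi> (c[j - 1 := m]))"

definition tensor_power_op :: "nat \<Rightarrow> complex^3^3 \<Rightarrow> state \<Rightarrow> state" where
  "tensor_power_op N A \<psi> = (\<lambda>c. if length c = N
     then \<Sum>d | length d = N. (\<Prod>i<N. A $ (c ! i) $ (d ! i)) * \<psi> d else 0)"

definition spin_matrix :: "3 \<Rightarrow> complex^3^3" where
  "spin_matrix a =
    (if a = 1 then
       (1 / sqrt 2) *\<^sub>R vector [vector [0, 1, 0],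
                             vector [1, 0, 1],
                             vector [0, 1, 0]]
     else if a = 2 then
       (1 / sqrt 2) *\<^sub>R vector [vector [0, - \<i>, 0],
                             vector [\<i>, 0, - \<i>],
                             vector [0, \<i>, 0]]
     else
       vector [vector [1, 0, 0],
               vector [0, 0, 0],
               vector [0, 0, - 1]])"

definition flip_matrix :: "complex^3^3" where
  "flip_matrix = vector [vector [0, 0, 1],
                         vector [0, 1, 0],
                         vector [1, 0, 0]]"

text \<open>
  \<open>spin_op N a j\<close> is \<open>s\<^sup>a\<^sub>j\<close> for \<open>1 \<le> j \<le> N\<close>; the site \<open>j = N + 1\<close> implements the diagonal twist.
\<close>

definition spin_op :: "nat \<Rightarrow> 3 \<Rightarrow> nat \<Rightarrow> state \<Rightarrow> state" where
  "spin_op N a j \<psi> =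
    (if j = N + 1
     then (\<lambda>c. (if a = 3 then 1 else - 1) * site_op (spin_matrix a) 1 \<psi> c)
     else site_op (spin_matrix a) j \<psi>)"

definition coupling_J :: "real \<Rightarrow> 3 \<Rightarrow> real" where
  "coupling_J x a = (if a = 3 then (x\<^sup>2 - 2) / 2 else 1)"

definition coupling_A :: "real \<Rightarrow> 3 \<Rightarrow> 3 \<Rightarrow> real" where
  "coupling_A x a b = (if a = b then coupling_J x a else if a = 3 \<or> b = 3 then x - 1 else 1)"

definition hamiltonian :: "nat \<Rightarrow> real \<Rightarrow> state \<Rightarrow> state" where
  "hamiltonian N x \<psi> = (\<lambda>c. \<Sum>j=1..N.
     (\<Sum>a\<in>UNIV. of_real (coupling_J x a) *
        ((spin_op N a j \<circ> spin_op N a (j + 1)) \<psi> c + 2 * (spin_op N a j ^^ 2) \<psi> c))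
     - (\<Sum>a\<in>UNIV. \<Sum>b\<in>UNIV. of_real (coupling_A x a b) *
        (spin_op N a j \<circ> spin_op N b j \<circ> spin_op N a (j + 1) \<circ> spin_op N b (j + 1)) \<psi> c))"

definition spin_reversal :: "nat \<Rightarrow> state \<Rightarrow> state" where
  "spin_reversal N = tensor_power_op N flip_matrix"

definition magnetisation :: "nat \<Rightarrow> state \<Rightarrow> state" where
  "magnetisation N \<psi> = (\<lambda>c. \<Sum>j=1..N. spin_op N 3 j \<psi> c)"

end

theory Submission imports Defs begin

text \<open>
  Dynamical supersymmetry. On vectors that are invariant under the twisted translation, up to the
  sign \<open>(- 1)\<^sup>N\<^sup>-\<^sup>1\<close>, the Hamiltonian is \<open>D Q + Q D\<close>, where \<open>Q\<close> adds a site, \<open>D\<close> removes one, \<open>D\<close> is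
  the adjoint of \<open>Q\<close> up to a positive factor, and \<open>D\<^sup>2 = 0\<close>. Here \<open>D\<close> is the differential of
  a cyclic complex: it contracts neighbouring sites with the product of the algebra of \<open>2 \<times> 2\<close> matrices
  modulo scalars, deformed by \<open>\<alpha> = - x / 2\<close>, and the twist is conjugation by \<open>diag(1, -1)\<close>. Zero-energy
  vectors are thus harmonic representatives of homology classes, so it suffices to exhibit a cycle
  \<open>c\<close> and a cocycle \<open>d\<close> with \<open>\<langle>c, d\<rangle> \<noteq> 0\<close>: the component of \<open>c\<close> orthogonal to the image of \<open>D\<close> is then
  non-zero and annihilated by both \<open>D\<close> and \<open>Q\<close>. Working with explicit \<open>c\<close> and \<open>d\<close> that are polynomial
  in \<open>x\<close> covers the point \<open>x = 0\<close>, at which the algebra degenerates to an exterior algebra.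
\<close>

section \<open>Twisted cyclic vectors\<close>

definition letter_sign :: "3 \<Rightarrow> real" where
  "letter_sign a = (if a = 2 then 1 else - 1)"

definition spin :: "3 \<Rightarrow> int" where
  "spin a = (if a = 1 then 1 else if a = 2 then 0 else - 1)"

definition word_sign :: "3 list \<Rightarrow> real" where
  "word_sign w = prod_list (map letter_sign w)"

definition word_spin :: "3 list \<Rightarrow> int" where
  "word_spin w = sum_list (map spin w)"

text \<open>The twisted translation, multiplied by the sign \<open>(- 1)\<^sup>n\<^sup>-\<^sup>1\<close> of the cyclic permutation of \<open>n\<close>
  factors.\<close>

definition rot :: "(3 list \<Rightarrow> real) \<Rightarrow> 3 list \<Rightarrow> real" where
  "rot f w = (case w of [] \<Rightarrow> 0 | a # r \<Rightarrow> (- 1) ^ length r * letter_sign a * f (r @ [a]))"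

text \<open>On neutral vectors of length \<open>n > 0\<close> this is \<open>n\<close> times the
  projection onto the \<open>rot\<close>-invariant ones; it is left unnormalised, as in cyclic
  homology.\<close>

definition cyc_sum :: "nat \<Rightarrow> (3 list \<Rightarrow> real) \<Rightarrow> 3 list \<Rightarrow> real" where
  "cyc_sum n f w = (\<Sum>k<n. (rot ^^ k) f w)"

definition neutral :: "nat \<Rightarrow> (3 list \<Rightarrow> real) \<Rightarrow> bool" where
  "neutral n f \<longleftrightarrow> (\<forall>w. f w \<noteq> 0 \<longrightarrow> length w = n \<and> word_spin w = 0)"

definition cyclic :: "nat \<Rightarrow> (3 list \<Rightarrow> real) \<Rightarrow> bool" where
  "cyclic n f \<longleftrightarrow> neutral n f \<and> rot f = f"

definition words :: "nat \<Rightarrow> 3 list set" where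
  "words n = {w. length w = n}"

definition pairing :: "nat \<Rightarrow> (3 list \<Rightarrow> real) \<Rightarrow> (3 list \<Rightarrow> real) \<Rightarrow> real" where
  "pairing n f g = (\<Sum>w\<in>words n. f w * g w)"

lemma letter_sign_simps [simp]: "letter_sign 1 = - 1" "letter_sign 2 = 1" "letter_sign 3 = - 1"
  by (simp_all add: letter_sign_def)

lemma spin_simps [simp]: "spin 1 = 1" "spin 2 = 0" "spin 3 = - 1"
  by (simp_all add: spin_def)

lemma letter_sign_square [simp]: "letter_sign a * letter_sign a = 1" "letter_sign a * (letter_sign a * b) = b"
  by (simp_all add: letter_sign_def)

lemma word_sign_simps [simp]:
  "word_sign [] = 1" "word_sign (a # w) = letter_sign a * word_sign w"
  "word_sign (v @ w) = word_sign v * word_sign w"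
  by (simp_all add: word_sign_def)

lemma word_spin_simps [simp]:
  "word_spin [] = 0" "word_spin (a # w) = spin a + word_spin w"
  "word_spin (v @ w) = word_spin v + word_spin w"
  by (simp_all add: word_spin_def)

lemma word_sign_square [simp]: "word_sign w * word_sign w = 1" "word_sign w * (word_sign w * b) = b"
proof -
  show *: "word_sign w * word_sign w = 1"
    by (induction w) (simp_all add: algebra_simps)
  show "word_sign w * (word_sign w * b) = b"
    using * by (metis mult.assoc mult_1)
qed

text \<open>Each \<open>letter_sign\<close> is \<open>- 1\<close> to the power of the spin, so the
  twist acts trivially on words of spin zero.\<close>

lemma word_sign_eq: "word_sign w = (if even (word_spin w) then 1 else - 1)"
proof (induction w)
  case (Cons a w)
  then show ?case using exhaust_3[of a] by auto
qed simp

lemma word_sign_cases: "word_sign w = 1 \<or> word_sign w = - 1"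
  by (simp add: word_sign_eq)

lemma word_sign_neutral [simp]: "word_spin w = 0 \<Longrightarrow> word_sign w = 1"
  by (simp add: word_sign_eq)

lemma finite_words [simp]: "finite (words n)"
  using finite_lists_length_eq[of "UNIV :: 3 set" n] by (simp add: words_def)

lemma sum_words_Cons: "(\<Sum>w\<in>words (Suc n). f w) = (\<Sum>a\<in>UNIV. \<Sum>r\<in>words n. f (a # r))"
proof -
  have "words (Suc n) = (\<lambda>(a, r). a # r) ` (UNIV \<times> words n)"
    by (auto simp: words_def length_Suc_conv image_iff)
  moreover have "inj_on (\<lambda>(a, r). a # r) (UNIV \<times> words n)"
    by (auto simp: inj_on_def)
  ultimately show ?thesis
    by (simp add: sum.reindex sum.cartesian_product case_prod_unfold)
qed

lemma sum_words_snoc: "(\<Sum>w\<in>words (Suc n). f w) = (\<Sum>a\<in>UNIV. \<Sum>r\<in>words n. f (r @ [a]))"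
proof -
  have "words (Suc n) = (\<lambda>(a, r). r @ [a]) ` (UNIV \<times> words n)"
    by (auto simp: words_def length_Suc_conv_rev image_iff)
  moreover have "inj_on (\<lambda>(a, r). r @ [a]) (UNIV \<times> words n)"
    by (auto simp: inj_on_def)
  ultimately show ?thesis
    by (simp add: sum.reindex sum.cartesian_product case_prod_unfold)
qed

section \<open>Powers of the twisted translation and rotation sums\<close>

lemma rot_simps [simp]:
  "rot f [] = 0" "rot f (a # r) = (- 1) ^ length r * letter_sign a * f (r @ [a])"
  by (simp_all add: rot_def)

text \<open>Each of the \<open>length x\<close> steps costs \<open>- 1\<close> to the power of the
  total length minus one. The exponent uses the total length plus one, which has the same parity and
  avoids truncated subtraction.\<close>

lemma rot_pow_append:
  assumes "x @ y \<noteq> []"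
  shows "(rot ^^ length x) f (x @ y) =
    (- 1) ^ ((length x + length y + 1) * length x) * word_sign x * f (y @ x)"
  using assms
proof (induction x arbitrary: y)
  case (Cons a x)
  have "(rot ^^ length (a # x)) f ((a # x) @ y) = (- 1) ^ (length x + length y) * letter_sign a * (rot ^^ length x) f (x @ (y @ [a]))"
    by simp
  also have "(rot ^^ length x) f (x @ (y @ [a])) =
    (- 1) ^ ((length x + length y + 2) * length x) * word_sign x * f ((y @ [a]) @ x)"
    by (subst Cons.IH) simp_all
  also have "(- 1) ^ (length x + length y) * letter_sign a * \<dots> =
    (- 1) ^ ((length x + length y) + (length x + length y + 2) * length x) * (letter_sign a * word_sign x) * f (y @ a # x)"
    by (simp only: power_add) simp
  also have "(- 1 :: real) ^ ((length x + length y) + (length x + length y + 2) * length x) =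
     (- 1) ^ ((length (a # x) + length y + 1) * length (a # x))"
    by (simp add: minus_one_power_iff)
  finally show ?case by simp
qed simp

lemma rot_pow_append_eq:
  assumes "length x = k" "length x + length y = m" "m > 0"
  shows "(rot ^^ k) f (x @ y) = (- 1) ^ ((m + 1) * k) * word_sign x * f (y @ x)"
  using rot_pow_append[of x y f] assms by force

lemma neutral_0: "neutral n f \<Longrightarrow> length w \<noteq> n \<or> word_spin w \<noteq> 0 \<Longrightarrow> f w = 0"
  by (auto simp: neutral_def)

lemma neutral_rot [simp]:
  assumes "neutral n f"
  shows "neutral n (rot f)"
  unfolding neutral_def
proof (intro allI impI)
  fix w assume "rot f w \<noteq> 0"
  then show "length w = n \<and> word_spin w = 0"
    using assms by (cases w) (auto simp: neutral_def)
qed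

lemma neutral_rot_pow [simp]: "neutral n f \<Longrightarrow> neutral n ((rot ^^ k) f)"
  by (induction k) simp_all

lemma neutral_eqI:
  assumes "neutral n f" "neutral n g"
    and "\<And>w. length w = n \<Longrightarrow> word_spin w = 0 \<Longrightarrow> f w = g w"
  shows "f = g"
proof
  fix w show "f w = g w"
    using assms neutral_0[OF assms(1), of w] neutral_0[OF assms(2), of w] by metis
qed

text \<open>A full turn produces \<open>(- 1) ^ ((n + 1) * n) = 1\<close> and the twist sign of the
  whole word, which is \<open>1\<close> at spin zero.\<close>

lemma rot_pow_neutral:
  assumes "neutral n f" "n > 0"
  shows "(rot ^^ n) f = f"
proof (rule neutral_eqI)
  fix w :: "3 list" assume w: "length w = n" "word_spin w = 0"
  have "(rot ^^ length w) f (w @ []) = (- 1) ^ ((length w + length ([] :: 3 list) + 1) * length w) * word_sign w * f ([] @ w)"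
    using w assms by (intro rot_pow_append) auto
  then show "(rot ^^ n) f w = f w"
    using w by (simp add: minus_one_power_iff)
qed (use assms in simp_all)

lemma cyclic_append:
  assumes "cyclic n f" "length x + length y = n" "n > 0"
  shows "f (x @ y) = (- 1) ^ ((n + 1) * length x) * word_sign x * f (y @ x)"
proof -
  have "(rot ^^ k) f = f" for k
    using assms(1) by (induction k) (simp_all add: cyclic_def)
  then show ?thesis
    using rot_pow_append[of x y f] assms by force
qed

lemma cyclic_Cons:
  assumes "cyclic n f" "Suc (length r) = n"
  shows "f (a # r) = (- 1) ^ length r * letter_sign a * f (r @ [a])"
  using assms by (metis cyclic_def rot_simps(2))

lemma rot_sum: "rot (\<lambda>w. \<Sum>i\<in>I. g i w) = (\<lambda>w. \<Sum>i\<in>I. rot (g i) w)"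
proof
  fix w show "rot (\<lambda>w. \<Sum>i\<in>I. g i w) w = (\<Sum>i\<in>I. rot (g i) w)"
    by (cases w) (simp_all add: sum_distrib_left)
qed

lemma rot_lin: "rot (\<lambda>w. f w + b * g w) = (\<lambda>w. rot f w + b * rot g w)"
proof
  fix w show "rot (\<lambda>w. f w + b * g w) w = rot f w + b * rot g w"
    by (cases w) (simp_all add: algebra_simps)
qed

lemma rot_pow_lin: "(rot ^^ k) (\<lambda>w. f w + b * g w) = (\<lambda>w. (rot ^^ k) f w + b * (rot ^^ k) g w)"
  by (induction k) (simp_all add: rot_lin)

lemma cyc_sum_lin: "cyc_sum n (\<lambda>w. f w + b * g w) = (\<lambda>w. cyc_sum n f w + b * cyc_sum n g w)"
  by (simp add: cyc_sum_def rot_pow_lin sum.distrib sum_distrib_left fun_eq_iff)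

lemma cyc_sum_zero: "cyc_sum n (\<lambda>w. 0) = (\<lambda>w. 0)"
proof -
  have "rot (\<lambda>w. 0) = (\<lambda>w. 0)"
    by (auto simp: rot_def fun_eq_iff split: list.split)
  then have "(rot ^^ k) (\<lambda>w. 0) = (\<lambda>w. 0)" for k
    by (induction k) auto
  then show ?thesis by (simp add: cyc_sum_def fun_eq_iff)
qed

lemma cyc_sum_sum:
  "cyc_sum n (\<lambda>w. \<Sum>i\<in>I. g i w) = (\<lambda>w. \<Sum>i\<in>I. cyc_sum n (g i) w)"
proof -
  have "(rot ^^ k) (\<lambda>w. \<Sum>i\<in>I. g i w) = (\<lambda>w. \<Sum>i\<in>I. (rot ^^ k) (g i) w)" for k
    by (induction k) (simp_all add: rot_sum)
  then show ?thesis
    by (simp add: cyc_sum_def fun_eq_iff sum.swap[of _ I])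
qed

text \<open>Consequently \<open>cyc_sum n\<close> annihilates \<open>g - rot g\<close>; remainders
  of this form are discarded in this way later.\<close>

lemma cyc_sum_rot:
  assumes "neutral n f" "n > 0"
  shows "cyc_sum n (rot f) = cyc_sum n f"
proof
  fix w
  have "(\<Sum>k<n. (rot ^^ k) (rot f) w) = (\<Sum>k<n. (rot ^^ Suc k) f w)"
    by (simp only: funpow_Suc_right o_apply)
  also have "\<dots> = (\<Sum>k<Suc n. (rot ^^ k) f w) - f w"
    by (subst sum.lessThan_Suc_shift) simp
  also have "\<dots> = (\<Sum>k<n. (rot ^^ k) f w)"
    using rot_pow_neutral[OF assms] by simp
  finally show "cyc_sum n (rot f) w = cyc_sum n f w"
    by (simp add: cyc_sum_def)
qed

lemma cyc_sum_rot_pow: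
  assumes "neutral n f" "n > 0"
  shows "cyc_sum n ((rot ^^ k) f) = cyc_sum n f"
  using assms by (induction k) (simp_all add: cyc_sum_rot)

lemma cyclic_cyc_sum:
  assumes "neutral n f" "n > 0"
  shows "cyclic n (cyc_sum n f)"
  unfolding cyclic_def
proof
  have "neutral n (\<lambda>w. \<Sum>k<n. (rot ^^ k) f w)"
    using neutral_rot_pow[OF assms(1)] unfolding neutral_def
    by (metis (no_types, lifting) sum.neutral)
  then show "neutral n (cyc_sum n f)" by (simp add: cyc_sum_def[abs_def])
  have "rot (cyc_sum n f) = cyc_sum n (rot f)"
    by (simp add: cyc_sum_def[abs_def] rot_sum funpow_swap1)
  then show "rot (cyc_sum n f) = cyc_sum n f"
    using cyc_sum_rot[OF assms] by simp
qed

text \<open>\<open>rot\<close> permutes the words of length \<open>n\<close> up to signs and is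
  therefore an isometry.\<close>

lemma pairing_rot:
  assumes "n > 0"
  shows "pairing n (rot f) (rot g) = pairing n f g"
proof -
  obtain m where n: "n = Suc m" using assms by (cases n) auto
  have "pairing n (rot f) (rot g) = (\<Sum>a\<in>UNIV. \<Sum>r\<in>words m. f (r @ [a]) * g (r @ [a]))"
    unfolding n pairing_def sum_words_Cons
    by (intro sum.cong refl) (simp add: letter_sign_def minus_one_power_iff)
  then show ?thesis
    by (simp add: n pairing_def sum_words_snoc)
qed

lemma pairing_cyc_sum:
  assumes "cyclic n g" "n > 0"
  shows "pairing n (cyc_sum n f) g = n * pairing n f g"
proof -
  have "pairing n ((rot ^^ k) f) g = pairing n f g" for k
  proof (induction k)
    case (Suc k)
    then show ?case
      using pairing_rot[OF assms(2), of "(rot ^^ k) f" g] assms(1) by (simp add: cyclic_def)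
  qed simp
  then have "(\<Sum>k<n. pairing n ((rot ^^ k) f) g) = n * pairing n f g"
    by simp
  then show ?thesis
    by (simp add: pairing_def cyc_sum_def sum_distrib_right sum.swap[of _ "words n"])
qed

lemma pairing_commute: "pairing n f g = pairing n g f"
  by (simp add: pairing_def mult.commute)

lemma pairing_lin:
  "pairing n (\<lambda>w. f w + b * g w) h = pairing n f h + b * pairing n g h"
  by (simp add: pairing_def algebra_simps sum.distrib sum_distrib_left)

section \<open>Fusion of neighbouring letters\<close>

text \<open>Structure constants modulo scalars: for \<open>\<alpha> \<noteq> 0\<close> the letters \<open>2\<close>, \<open>1\<close>, \<open>3\<close> stand for
  \<open>z = diag(\<alpha>, - \<alpha>)\<close> and for multiples \<open>e\<close>, \<open>f\<close> of the elementary matrices \<open>E\<^sub>1\<^sub>2\<close>, \<open>E\<^sub>2\<^sub>1\<close> with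
  \<open>e f = z + \<alpha>\<close>.\<close>

definition fusion :: "real \<Rightarrow> 3 \<Rightarrow> 3 \<Rightarrow> 3 \<Rightarrow> real" where
  "fusion \<alpha> u v a =
    (if (u, v, a) = (2, 1, 1) \<or> (u, v, a) = (3, 2, 3) then \<alpha>
     else if (u, v, a) = (1, 2, 1) \<or> (u, v, a) = (2, 3, 3) then - \<alpha>
     else if (u, v, a) = (1, 3, 2) then 1
     else if (u, v, a) = (3, 1, 2) then - 1 else 0)"

text \<open>Vectors are coordinate functions, so \<open>merge_first\<close> applies the product to
  the first two tensor factors and \<open>split_first\<close> is its transpose. Followed by
  \<open>cyc_sum\<close>, they become \<open>D\<close> and \<open>Q\<close>.\<close>

definition split_first :: "real \<Rightarrow> (3 list \<Rightarrow> real) \<Rightarrow> 3 list \<Rightarrow> real" where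
  "split_first \<alpha> f w =
    (case w of u # v # r \<Rightarrow> \<Sum>a\<in>UNIV. fusion \<alpha> u v a * f (a # r) | _ \<Rightarrow> 0)"

definition merge_first :: "real \<Rightarrow> (3 list \<Rightarrow> real) \<Rightarrow> 3 list \<Rightarrow> real" where
  "merge_first \<alpha> f w =
    (case w of a # r \<Rightarrow> \<Sum>u\<in>UNIV. \<Sum>v\<in>UNIV. fusion \<alpha> u v a * f (u # v # r) | _ \<Rightarrow> 0)"

lemma fusion_simps [simp]:
  "fusion \<alpha> 1 1 a = 0" "fusion \<alpha> 2 2 a = 0" "fusion \<alpha> 3 3 a = 0"
  "fusion \<alpha> 1 2 1 = - \<alpha>" "fusion \<alpha> 1 2 2 = 0" "fusion \<alpha> 1 2 3 = 0"
  "fusion \<alpha> 2 1 1 = \<alpha>" "fusion \<alpha> 2 1 2 = 0" "fusion \<alpha> 2 1 3 = 0"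
  "fusion \<alpha> 1 3 1 = 0" "fusion \<alpha> 1 3 2 = 1" "fusion \<alpha> 1 3 3 = 0"
  "fusion \<alpha> 3 1 1 = 0" "fusion \<alpha> 3 1 2 = - 1" "fusion \<alpha> 3 1 3 = 0"
  "fusion \<alpha> 2 3 1 = 0" "fusion \<alpha> 2 3 2 = 0" "fusion \<alpha> 2 3 3 = - \<alpha>"
  "fusion \<alpha> 3 2 1 = 0" "fusion \<alpha> 3 2 2 = 0" "fusion \<alpha> 3 2 3 = \<alpha>"
  by (simp_all add: fusion_def)

lemma split_first_simps [simp]:
  "split_first \<alpha> f [] = 0" "split_first \<alpha> f [u] = 0"
  "split_first \<alpha> f (u # v # r) = (\<Sum>a\<in>UNIV. fusion \<alpha> u v a * f (a # r))"
  by (simp_all add: split_first_def)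

lemma merge_first_simps [simp]:
  "merge_first \<alpha> f [] = 0"
  "merge_first \<alpha> f (a # r) = (\<Sum>u\<in>UNIV. \<Sum>v\<in>UNIV. fusion \<alpha> u v a * f (u # v # r))"
  by (simp_all add: merge_first_def)

lemma fusion_spin: "fusion \<alpha> u v a \<noteq> 0 \<Longrightarrow> spin a = spin u + spin v"
  by (auto simp: fusion_def split: if_splits)

text \<open>The twist is an automorphism of the product; this makes fusion compatible with the signs
  in \<open>rot\<close>.\<close>

lemma fusion_sign: "fusion \<alpha> u v a \<noteq> 0 \<Longrightarrow> letter_sign a = letter_sign u * letter_sign v"
  by (auto simp: fusion_def split: if_splits)

lemma neutral_split_first:
  assumes "neutral n f"
  shows "neutral (Suc n) (split_first \<alpha> f)"
  unfolding neutral_def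
proof (intro allI impI)
  fix w assume nz: "split_first \<alpha> f w \<noteq> 0"
  then obtain u v r where w: "w = u # v # r"
    by (metis split_first_simps(1,2) neq_Nil_conv)
  then obtain a where "fusion \<alpha> u v a * f (a # r) \<noteq> 0"
    using nz by (metis (no_types, lifting) split_first_simps(3) sum.neutral)
  then show "length w = Suc n \<and> word_spin w = 0"
    using assms fusion_spin[of \<alpha> u v a] by (auto simp: neutral_def w)
qed

lemma neutral_merge_first:
  assumes "neutral (Suc n) f"
  shows "neutral n (merge_first \<alpha> f)"
  unfolding neutral_def
proof (intro allI impI)
  fix w assume nz: "merge_first \<alpha> f w \<noteq> 0"
  then obtain a r where w: "w = a # r"
    by (metis merge_first_simps(1) neq_Nil_conv)
  then obtain u v where "fusion \<alpha> u v a * f (u # v # r) \<noteq> 0"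
    using nz by (metis (no_types, lifting) merge_first_simps(2) sum.neutral)
  then show "length w = n \<and> word_spin w = 0"
    using assms fusion_spin[of \<alpha> u v a] by (auto simp: neutral_def w)
qed

lemma split_first_sum:
  "split_first \<alpha> (\<lambda>w. \<Sum>i\<in>I. g i w) = (\<lambda>w. \<Sum>i\<in>I. split_first \<alpha> (g i) w)"
proof
  fix w show "split_first \<alpha> (\<lambda>w. \<Sum>i\<in>I. g i w) w = (\<Sum>i\<in>I. split_first \<alpha> (g i) w)"
    by (auto simp: split_first_def sum_distrib_left sum.swap[of _ I] split: list.split)
qed

lemma merge_first_sum:
  "merge_first \<alpha> (\<lambda>w. \<Sum>i\<in>I. g i w) = (\<lambda>w. \<Sum>i\<in>I. merge_first \<alpha> (g i) w)"
proof
  fix w show "merge_first \<alpha> (\<lambda>w. \<Sum>i\<in>I. g i w) w = (\<Sum>i\<in>I. merge_first \<alpha> (g i) w)"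
    by (auto simp: merge_first_def sum_distrib_left sum.swap[of _ I] split: list.split)
qed

lemma split_first_lin:
  "split_first \<alpha> (\<lambda>w. f w + b * g w) = (\<lambda>w. split_first \<alpha> f w + b * split_first \<alpha> g w)"
  by (auto simp: split_first_def fun_eq_iff algebra_simps sum.distrib sum_distrib_left split: list.split)

lemma merge_first_lin:
  "merge_first \<alpha> (\<lambda>w. f w + b * g w) = (\<lambda>w. merge_first \<alpha> f w + b * merge_first \<alpha> g w)"
  by (auto simp: merge_first_def fun_eq_iff algebra_simps sum.distrib sum_distrib_left split: list.split)

text \<open>With \<open>pairing_cyc_sum\<close> this makes \<open>D\<close> the adjoint of
  \<open>Q\<close> up to the ratio of the two lengths.\<close>

lemma pairing_split_first:
  "pairing (n + 2) (split_first \<alpha> f) g = pairing (n + 1) f (merge_first \<alpha> g)"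
proof -
  have "pairing (n + 2) (split_first \<alpha> f) g =
      (\<Sum>u\<in>UNIV. \<Sum>v\<in>UNIV. \<Sum>r\<in>words n. (\<Sum>a\<in>UNIV. fusion \<alpha> u v a * f (a # r)) * g (u # v # r))"
    by (simp add: pairing_def sum_words_Cons)
  also have "\<dots> = (\<Sum>a\<in>UNIV. \<Sum>r\<in>words n. f (a # r) * (\<Sum>u\<in>UNIV. \<Sum>v\<in>UNIV. fusion \<alpha> u v a * g (u # v # r)))"
    by (simp add: sum_3 algebra_simps sum.distrib sum_distrib_left sum_subtractf sum_negf)
  finally show ?thesis
    by (simp add: pairing_def sum_words_Cons)
qed

lemma sum_swap3:
  "(\<Sum>u\<in>A. \<Sum>v\<in>B. \<Sum>e\<in>C. g u v e) = (\<Sum>e\<in>C. \<Sum>u\<in>A. \<Sum>v\<in>B. g u v e)"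
proof -
  have "(\<Sum>u\<in>A. \<Sum>v\<in>B. \<Sum>e\<in>C. g u v e) = (\<Sum>u\<in>A. \<Sum>e\<in>C. \<Sum>v\<in>B. g u v e)"
    by (intro sum.cong refl sum.swap)
  then show ?thesis by (simp only: sum.swap[of _ A C])
qed

text \<open>For \<open>2 \<le> k < n\<close> the split pair and the merged pair are disjoint, so the two operations commute up
  to the sign of the complex.\<close>

lemma merge_rot_split:
  assumes f: "cyclic n f" and k: "2 \<le> k" "k < n"
  shows "merge_first \<alpha> ((rot ^^ k) (split_first \<alpha> f)) =
    (\<lambda>w. - (rot ^^ (k - 1)) (split_first \<alpha> ((rot ^^ (n - k)) (merge_first \<alpha> f))) w)"
proof (rule neutral_eqI)
  obtain m where m: "n = Suc m" using k by (cases n) auto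
  have nf: "neutral n f" using f by (simp add: cyclic_def)
  have nm: "neutral m (merge_first \<alpha> f)" using nf m neutral_merge_first by blast
  show "neutral n (merge_first \<alpha> ((rot ^^ k) (split_first \<alpha> f)))"
    by (intro neutral_merge_first neutral_rot_pow neutral_split_first nf)
  have "neutral n ((rot ^^ (k - 1)) (split_first \<alpha> ((rot ^^ (n - k)) (merge_first \<alpha> f))))"
    unfolding m by (intro neutral_rot_pow neutral_split_first nm)
  then show "neutral n (\<lambda>w. - (rot ^^ (k - 1)) (split_first \<alpha> ((rot ^^ (n - k)) (merge_first \<alpha> f))) w)"
    by (simp add: neutral_def)
next
  fix w :: "3 list" assume w: "length w = n" "word_spin w = 0"
  obtain a w' where a: "w = a # w'" using w k by (cases w) auto
  \<comment> \<open>In \<open>w = a x c d z\<close> the letter \<open>a\<close> results from merging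
    a pair \<open>u v\<close>, while \<open>c d\<close> results from splitting a letter
    \<open>e\<close>; the block \<open>x\<close> separates them, whence
    \<open>k = length x + 2\<close>.\<close>
  define x where "x = take (k - 2) w'"
  have "k - 2 < length w'" "Suc (k - 2) < length w'" using w a k by simp_all
  then obtain c d z where cdz: "drop (k - 2) w' = c # d # z"
    by (metis Cons_nth_drop_Suc)
  have wx: "w = a # x @ c # d # z"
    using a cdz by (metis append_take_drop_id x_def)
  have lx: "k = length x + 2" using w a k by (simp add: x_def)
  have lz: "n = length x + length z + 3" using w wx by simp
  have sgn: "word_sign (c # d # z) = word_sign (a # x)"
  proof -
    have "word_sign (a # x) * word_sign (c # d # z) = 1"
      using word_sign_neutral[OF w(2)] unfolding wx by (simp add: algebra_simps)
    then show ?thesis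
      by (metis mult.assoc mult.commute mult_1 word_sign_square(1))
  qed
  \<comment> \<open>The exponents keep the shape \<open>(m + 1) * k\<close> of
    \<open>rot_pow_append_eq\<close>, where \<open>m\<close> is the length of the rotated words:
    \<open>n + 1\<close> after a split, \<open>n - 1\<close> after a merge, \<open>n\<close>
    otherwise.\<close>
  have lhs: "(rot ^^ k) (split_first \<alpha> f) (u # v # x @ c # d # z) =
      (- 1) ^ ((n + 1 + 1) * k) * word_sign (u # v # x) * (\<Sum>e\<in>UNIV. fusion \<alpha> c d e * f (e # z @ u # v # x))" for u v
    using rot_pow_append_eq[of "u # v # x" k "c # d # z" "n + 1" "split_first \<alpha> f"] by (simp add: lx lz del: funpow.simps)
  have rhs1: "(rot ^^ (k - 1)) g w = (- 1) ^ ((n + 1) * (k - 1)) * word_sign (a # x) * g (c # d # z @ a # x)" for g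
    using rot_pow_append_eq[of "a # x" "k - 1" "c # d # z" n g] by (simp add: wx lx lz del: funpow.simps)
  have rhs2: "(rot ^^ (n - k)) g (e # z @ a # x) = (- 1) ^ ((n - 1 + 1) * (n - k)) * word_sign (e # z) * g (a # x @ e # z)" for g e
    using rot_pow_append_eq[of "e # z" "n - k" "a # x" "n - 1" g] by (simp add: lx lz del: funpow.simps)
  have cyc: "f (u # v # x @ e # z) = (- 1) ^ ((n + 1) * k) * word_sign (u # v # x) * f (e # z @ u # v # x)" for u v e
    using cyclic_append[OF f, of "u # v # x" "e # z"] by (simp add: lx lz)
  \<comment> \<open>Where the structure constants do not vanish, \<open>fusion_sign\<close> and the
    neutrality of \<open>w\<close> turn every word sign into that of \<open>a # x\<close>; the
    powers of \<open>- 1\<close> then leave one minus sign.\<close>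
  have coef: "fusion \<alpha> u v a * ((- 1) ^ ((n + 1 + 1) * k) * word_sign (u # v # x) * (fusion \<alpha> c d e * X)) =
      - ((- 1) ^ ((n + 1) * (k - 1)) * word_sign (a # x) * (fusion \<alpha> c d e * ((- 1) ^ ((n - 1 + 1) * (n - k)) * word_sign (e # z) *
        (fusion \<alpha> u v a * ((- 1) ^ ((n + 1) * k) * word_sign (u # v # x) * X)))))" for u v e X
  proof (cases "fusion \<alpha> u v a = 0 \<or> fusion \<alpha> c d e = 0")
    case False
    then have 1: "word_sign (u # v # x) = word_sign (a # x)" and 2: "word_sign (e # z) = word_sign (a # x)"
      using fusion_sign[of \<alpha> u v a] fusion_sign[of \<alpha> c d e] sgn by (simp_all add: algebra_simps)
    show ?thesis
      unfolding 1 2 using word_sign_cases[of "a # x"]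
      by (elim disjE) (simp_all add: lx lz minus_one_power_iff del: word_sign_simps)
  qed auto
  have "merge_first \<alpha> ((rot ^^ k) (split_first \<alpha> f)) w =
     (\<Sum>u\<in>UNIV. \<Sum>v\<in>UNIV. \<Sum>e\<in>UNIV. fusion \<alpha> u v a *
       ((- 1) ^ ((n + 1 + 1) * k) * word_sign (u # v # x) * (fusion \<alpha> c d e * f (e # z @ u # v # x))))"
    unfolding wx merge_first_simps lhs by (simp only: sum_distrib_left)
  also have "\<dots> = - (\<Sum>u\<in>UNIV. \<Sum>v\<in>UNIV. \<Sum>e\<in>UNIV. (- 1) ^ ((n + 1) * (k - 1)) * word_sign (a # x) * (fusion \<alpha> c d e * ((- 1) ^ ((n - 1 + 1) * (n - k)) * word_sign (e # z) *
        (fusion \<alpha> u v a * f (u # v # x @ e # z)))))"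
    unfolding coef cyc by (simp only: sum_negf)
  also have "\<dots> = - (rot ^^ (k - 1)) (split_first \<alpha> ((rot ^^ (n - k)) (merge_first \<alpha> f))) w"
    unfolding rhs1 split_first_simps rhs2 merge_first_simps sum_distrib_left
    by (subst sum_swap3) (rule refl)
  finally show "merge_first \<alpha> ((rot ^^ k) (split_first \<alpha> f)) w =
     - (rot ^^ (k - 1)) (split_first \<alpha> ((rot ^^ (n - k)) (merge_first \<alpha> f))) w" .
qed

section \<open>The square of the fusion differential\<close>

text \<open>Merges of disjoint pairs anticommute. Performing the other merge first changes the
  distance \<open>k\<close> between the pairs, measured around the circle, to
  \<open>n - k\<close>.\<close>

lemma merge_rot_merge:
  assumes f: "cyclic n f" and k: "2 \<le> k" "k \<le> n - 2"
  shows "merge_first \<alpha> ((rot ^^ k) (merge_first \<alpha> f)) =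
    (\<lambda>w. - (rot ^^ (k - 1)) (merge_first \<alpha> ((rot ^^ (n - k)) (merge_first \<alpha> f))) w)"
proof (rule neutral_eqI)
  define m where "m = n - 2"
  then have m: "n = Suc (Suc m)" using k by simp
  have nf: "neutral (Suc (Suc m)) f" using f m by (simp add: cyclic_def)
  show "neutral m (merge_first \<alpha> ((rot ^^ k) (merge_first \<alpha> f)))"
    by (intro neutral_merge_first neutral_rot_pow nf)
  have "neutral m ((rot ^^ (k - 1)) (merge_first \<alpha> ((rot ^^ (n - k)) (merge_first \<alpha> f))))"
    by (intro neutral_merge_first neutral_rot_pow nf)
  then show "neutral m (\<lambda>w. - (rot ^^ (k - 1)) (merge_first \<alpha> ((rot ^^ (n - k)) (merge_first \<alpha> f))) w)"
    by (simp add: neutral_def)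
  fix w :: "3 list" assume w: "length w = m" "word_spin w = 0"
  obtain a w' where a: "w = a # w'" using w k m by (cases w) auto
  \<comment> \<open>Now \<open>w = a x c z\<close>, with \<open>a\<close> merged from
    \<open>u v\<close> and \<open>c\<close> merged from \<open>u' v'\<close>.\<close>
  define x where "x = take (k - 2) w'"
  have "k - 2 < length w'" using w a k m by simp
  then obtain c z where cz: "drop (k - 2) w' = c # z"
    by (metis Cons_nth_drop_Suc)
  have wx: "w = a # x @ c # z"
    using a cz by (metis append_take_drop_id x_def)
  have lx: "k = length x + 2" using w a k m by (simp add: x_def)
  have lz: "n = length x + length z + 4" using w wx m by simp
  have sgn: "word_sign (c # z) = word_sign (a # x)"
  proof -
    have "word_sign (a # x) * word_sign (c # z) = 1"
      using word_sign_neutral[OF w(2)] unfolding wx by (simp add: algebra_simps)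
    then show ?thesis
      by (metis mult.assoc mult.commute mult_1 word_sign_square(1))
  qed
  have lhs: "(rot ^^ k) (merge_first \<alpha> f) (u # v # x @ c # z) =
      (- 1) ^ ((n - 1 + 1) * k) * word_sign (u # v # x) *
      (\<Sum>u'\<in>UNIV. \<Sum>v'\<in>UNIV. fusion \<alpha> u' v' c * f (u' # v' # z @ u # v # x))" for u v
    using rot_pow_append_eq[of "u # v # x" k "c # z" "n - 1" "merge_first \<alpha> f"] by (simp add: lx lz del: funpow.simps)
  have rhs1: "(rot ^^ (k - 1)) g w = (- 1) ^ ((n - 2 + 1) * (k - 1)) * word_sign (a # x) * g (c # z @ a # x)" for g
    using rot_pow_append_eq[of "a # x" "k - 1" "c # z" "n - 2" g] by (simp add: wx lx lz del: funpow.simps)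
  have rhs2: "(rot ^^ (n - k)) g (u' # v' # z @ a # x) = (- 1) ^ ((n - 1 + 1) * (n - k)) * word_sign (u' # v' # z) * g (a # x @ u' # v' # z)" for g u' v'
    using rot_pow_append_eq[of "u' # v' # z" "n - k" "a # x" "n - 1" g] by (simp add: lx lz del: funpow.simps)
  have cyc: "f (u # v # x @ u' # v' # z) = (- 1) ^ ((n + 1) * k) * word_sign (u # v # x) * f (u' # v' # z @ u # v # x)" for u v u' v'
    using cyclic_append[OF f, of "u # v # x" "u' # v' # z"] by (simp add: lx lz)
  have coef: "fusion \<alpha> u v a * ((- 1) ^ ((n - 1 + 1) * k) * word_sign (u # v # x) * (fusion \<alpha> u' v' c * X)) =
      - ((- 1) ^ ((n - 2 + 1) * (k - 1)) * word_sign (a # x) * (fusion \<alpha> u' v' c * ((- 1) ^ ((n - 1 + 1) * (n - k)) * word_sign (u' # v' # z) *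
        (fusion \<alpha> u v a * ((- 1) ^ ((n + 1) * k) * word_sign (u # v # x) * X)))))" for u v u' v' X
  proof (cases "fusion \<alpha> u v a = 0 \<or> fusion \<alpha> u' v' c = 0")
    case False
    then have 1: "word_sign (u # v # x) = word_sign (a # x)" and 2: "word_sign (u' # v' # z) = word_sign (a # x)"
      using fusion_sign[of \<alpha> u v a] fusion_sign[of \<alpha> u' v' c] sgn by (simp_all add: algebra_simps)
    show ?thesis
      unfolding 1 2 using word_sign_cases[of "a # x"]
      by (elim disjE) (simp_all add: lx lz minus_one_power_iff del: word_sign_simps)
  qed auto
  have "merge_first \<alpha> ((rot ^^ k) (merge_first \<alpha> f)) w =
     (\<Sum>u\<in>UNIV. \<Sum>v\<in>UNIV. \<Sum>u'\<in>UNIV. \<Sum>v'\<in>UNIV. fusion \<alpha> u v a *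
       ((- 1) ^ ((n - 1 + 1) * k) * word_sign (u # v # x) * (fusion \<alpha> u' v' c * f (u' # v' # z @ u # v # x))))"
    unfolding wx merge_first_simps lhs by (simp only: sum_distrib_left)
  also have "\<dots> = - (\<Sum>u\<in>UNIV. \<Sum>v\<in>UNIV. \<Sum>u'\<in>UNIV. \<Sum>v'\<in>UNIV. (- 1) ^ ((n - 2 + 1) * (k - 1)) * word_sign (a # x) * (fusion \<alpha> u' v' c * ((- 1) ^ ((n - 1 + 1) * (n - k)) * word_sign (u' # v' # z) *
        (fusion \<alpha> u v a * f (u # v # x @ u' # v' # z)))))"
    unfolding coef cyc by (simp only: sum_negf)
  also have "\<dots> = - (rot ^^ (k - 1)) (merge_first \<alpha> ((rot ^^ (n - k)) (merge_first \<alpha> f))) w"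
    unfolding rhs1 merge_first_simps rhs2 sum_distrib_left
    by (subst sum_swap3, subst (2) sum_swap3) (rule refl)
  finally show "merge_first \<alpha> ((rot ^^ k) (merge_first \<alpha> f)) w =
     - (rot ^^ (k - 1)) (merge_first \<alpha> ((rot ^^ (n - k)) (merge_first \<alpha> f))) w" .
qed

text \<open>The scalar part of the product of two letters; it measures the failure of associativity modulo
  scalars.\<close>

definition curvature :: "real \<Rightarrow> 3 \<Rightarrow> 3 \<Rightarrow> real" where
  "curvature \<alpha> u v = (if u = 2 \<and> v = 2 then \<alpha>\<^sup>2 else if u \<noteq> 2 \<and> v \<noteq> 2 \<and> u \<noteq> v then \<alpha> else 0)"

text \<open>In the full matrix algebra a product of letters is its fusion plus
  \<open>curvature\<close> times the identity; the identity compares letter components in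
  \<open>(u v) w = u (v w)\<close>. The check by cases also covers
  \<open>\<alpha> = 0\<close>.\<close>

lemma fusion_associator:
  "(\<Sum>t\<in>UNIV. fusion \<alpha> u v t * fusion \<alpha> t w a) - (\<Sum>t\<in>UNIV. fusion \<alpha> u t a * fusion \<alpha> v w t) =
    (if u = a then curvature \<alpha> v w else 0) - (if w = a then curvature \<alpha> u v else 0)"
  using exhaust_3[of u] exhaust_3[of v] exhaust_3[of w] exhaust_3[of a]
  by (elim disjE) (simp_all add: sum_3 curvature_def power2_eq_square)

text \<open>The two ways of merging three consecutive letters enter with opposite signs and form the
  associator. Its two curvature terms are related by one rotation, so they disappear under
  \<open>cyc_sum\<close>.\<close>

lemma merge_merge_curvature:
  fixes \<alpha> :: real
  assumes f: "cyclic n f" and n: "n \<ge> 3" and lw: "length w = n - 2"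
  defines "g \<equiv> (\<lambda>r. \<Sum>u\<in>UNIV. \<Sum>v\<in>UNIV. curvature \<alpha> u v * f (u # v # r))"
  shows "merge_first \<alpha> (merge_first \<alpha> f) w + merge_first \<alpha> (rot (merge_first \<alpha> f)) w =
    rot g w - g w"
proof -
  obtain a r where w: "w = a # r" using n lw by (cases w) auto
  have lr: "length r = n - 3" using lw w by simp
  have 1: "f (u # v # t # r) = (- 1) ^ (length r + 2) * letter_sign u * f (v # t # r @ [u])" for u v t
    using cyclic_Cons[OF f, of "v # t # r" u] lr n by simp
  have "merge_first \<alpha> (rot (merge_first \<alpha> f)) w =
    - (\<Sum>u\<in>UNIV. \<Sum>t\<in>UNIV. \<Sum>v\<in>UNIV. \<Sum>s\<in>UNIV. fusion \<alpha> u t a * fusion \<alpha> v s t * f (u # v # s # r))"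
    unfolding w 1 by (simp add: sum_distrib_left sum_negf [symmetric] algebra_simps)
  moreover have "merge_first \<alpha> (merge_first \<alpha> f) w =
    (\<Sum>t\<in>UNIV. \<Sum>s\<in>UNIV. \<Sum>u\<in>UNIV. \<Sum>v\<in>UNIV. fusion \<alpha> u v t * fusion \<alpha> t s a * f (u # v # s # r))"
    unfolding w by (simp add: sum_distrib_left algebra_simps)
  ultimately have "merge_first \<alpha> (merge_first \<alpha> f) w + merge_first \<alpha> (rot (merge_first \<alpha> f)) w =
    (\<Sum>u\<in>UNIV. \<Sum>v\<in>UNIV. \<Sum>s\<in>UNIV. ((\<Sum>t\<in>UNIV. fusion \<alpha> u v t * fusion \<alpha> t s a) - (\<Sum>t\<in>UNIV. fusion \<alpha> u t a * fusion \<alpha> v s t)) * f (u # v # s # r))"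
    unfolding sum_3 by algebra
  also have "\<dots> = (\<Sum>u\<in>UNIV. \<Sum>v\<in>UNIV. \<Sum>s\<in>UNIV. ((if u = a then curvature \<alpha> v s else 0) - (if s = a then curvature \<alpha> u v else 0)) * f (u # v # s # r))"
    unfolding fusion_associator ..
  also have "\<dots> = (\<Sum>v\<in>UNIV. \<Sum>s\<in>UNIV. curvature \<alpha> v s * f (a # v # s # r)) -
      (\<Sum>u\<in>UNIV. \<Sum>v\<in>UNIV. curvature \<alpha> u v * f (u # v # a # r))"
    using exhaust_3[of a] by (elim disjE) (simp_all add: sum_3 algebra_simps)
  also have "\<dots> = rot g w - g w"
    unfolding w g_def 1[of a] by (simp add: sum_distrib_left algebra_simps)
  finally show ?thesis .
qed

text \<open>This is \<open>D\<^sup>2 = 0\<close>: the overlapping merges \<open>k = 0\<close> and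
  \<open>k = 1\<close> cancel by near-associativity, the disjoint ones in pairs \<open>k\<close>,
  \<open>n - k\<close>.\<close>

lemma merge_square_zero:
  assumes f: "cyclic n f" and n: "n \<ge> 3"
  shows "cyc_sum (n - 2) (merge_first \<alpha> (cyc_sum (n - 1) (merge_first \<alpha> f))) = (\<lambda>w. 0)"
proof -
  define m where "m = n - 2"
  then have m: "n = Suc (Suc m)" "m > 0" using n by simp_all
  have nf: "neutral (Suc (Suc m)) f" using f m by (simp add: cyclic_def)
  define A where "A k = merge_first \<alpha> ((rot ^^ k) (merge_first \<alpha> f))" for k
  have nA: "neutral m (A k)" for k
    unfolding A_def by (intro neutral_merge_first neutral_rot_pow nf)
  define g where "g r = (\<Sum>u\<in>UNIV. \<Sum>v\<in>UNIV. curvature \<alpha> u v * f (u # v # r))" for r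
  \<comment> \<open>Contraction with \<open>curvature\<close> preserves neutrality because it is
    non-zero only on pairs of total spin zero.\<close>
  have ng: "neutral m g"
    unfolding neutral_def
  proof (intro allI impI)
    fix r assume "g r \<noteq> 0"
    then obtain u v where "curvature \<alpha> u v * f (u # v # r) \<noteq> 0"
      unfolding g_def by (metis (no_types, lifting) sum.neutral)
    then have "curvature \<alpha> u v \<noteq> 0" "length r = m" "spin u + spin v + word_spin r = 0"
      using nf by (auto simp: neutral_def)
    then show "length r = m \<and> word_spin r = 0"
      using exhaust_3[of u] exhaust_3[of v] by (auto simp: curvature_def split: if_splits)
  qed
  \<comment> \<open>The explicit coefficients \<open>1\<close> and \<open>- 1\<close> give both
    sides the shape of \<open>cyc_sum_lin\<close>.\<close>
  have "(\<lambda>w. A 0 w + 1 * A 1 w) = (\<lambda>w. rot g w + (- 1) * g w)"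
  proof (rule neutral_eqI)
    show "neutral m (\<lambda>w. A 0 w + 1 * A 1 w)"
      using nA[of 0] nA[of 1] unfolding neutral_def by (metis add.right_neutral mult_zero_right)
    show "neutral m (\<lambda>w. rot g w + (- 1) * g w)"
      using ng neutral_rot[OF ng] unfolding neutral_def by (metis add.right_neutral mult_zero_right)
    show "A 0 w + 1 * A 1 w = rot g w + (- 1) * g w" if "length w = m" for w
      using merge_merge_curvature[OF f n, where w = w and \<alpha> = \<alpha>] that m by (simp add: A_def g_def[abs_def])
  qed
  from arg_cong[OF this, of "cyc_sum m"]
  have 01: "cyc_sum m (A 0) w + cyc_sum m (A 1) w = 0" for w
    unfolding cyc_sum_lin by (simp add: cyc_sum_rot[OF ng m(2)] fun_eq_iff)
  have anti: "cyc_sum m (A k) w = - cyc_sum m (A (n - k)) w" if "k \<in> {2..m}" for k w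
  proof -
    have "cyc_sum m (A k) = cyc_sum m (\<lambda>w. 0 + (- 1) * (rot ^^ (k - 1)) (A (n - k)) w)"
      using merge_rot_merge[OF f, where k = k and \<alpha> = \<alpha>] that m by (simp add: A_def)
    then show ?thesis
      unfolding cyc_sum_lin cyc_sum_rot_pow[OF nA m(2)] cyc_sum_zero by simp
  qed
  have "(\<Sum>k\<in>{2..m}. cyc_sum m (A k) w) = 0" for w
  proof -
    \<comment> \<open>The sum equals its own negative, which also settles the fixed point
      \<open>k = n / 2\<close> of the reflection for even \<open>n\<close>.\<close>
    have "(\<Sum>k\<in>{2..m}. cyc_sum m (A k) w) = (\<Sum>k\<in>{2..m}. cyc_sum m (A (n - k)) w)"
      by (rule sum.reindex_bij_witness[of _ "\<lambda>k. n - k" "\<lambda>k. n - k"]) (auto simp: m)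
    also have "\<dots> = - (\<Sum>k\<in>{2..m}. cyc_sum m (A k) w)"
      unfolding sum_negf [symmetric] using anti by (intro sum.cong) simp_all
    finally show ?thesis by simp
  qed
  moreover have "{..<Suc m} = insert 0 (insert 1 {2..m})" using m by auto
  ultimately have "(\<Sum>k<Suc m. cyc_sum m (A k) w) = 0" for w
    using 01[of w] by simp
  moreover have "cyc_sum m (merge_first \<alpha> (\<lambda>w. \<Sum>k<Suc m. (rot ^^ k) (merge_first \<alpha> f) w)) w = (\<Sum>k<Suc m. cyc_sum m (A k) w)" for w
    unfolding merge_first_sum cyc_sum_sum A_def ..
  ultimately show ?thesis
    by (intro ext) (simp add: m cyc_sum_def[of "Suc m", abs_def])
qed

section \<open>The bond operator\<close>

text \<open>The part of \<open>D Q + Q D\<close> in which the split and the merged pair overlap.\<close>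

definition bond_kernel :: "real \<Rightarrow> 3 \<Rightarrow> 3 \<Rightarrow> 3 \<Rightarrow> 3 \<Rightarrow> real" where
  "bond_kernel \<alpha> u v m m' =
    (if v = m' then \<Sum>s\<in>UNIV. \<Sum>t\<in>UNIV. fusion \<alpha> s t u * fusion \<alpha> s t m else 0)
    - (\<Sum>s\<in>UNIV. fusion \<alpha> m s u * fusion \<alpha> s v m')
    - (\<Sum>s\<in>UNIV. fusion \<alpha> s m' v * fusion \<alpha> u s m)
    + (\<Sum>s\<in>UNIV. fusion \<alpha> u v s * fusion \<alpha> m m' s)"

definition bond_op :: "(3 \<Rightarrow> 3 \<Rightarrow> 3 \<Rightarrow> 3 \<Rightarrow> real) \<Rightarrow> (3 list \<Rightarrow> real) \<Rightarrow> 3 list \<Rightarrow> real" where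
  "bond_op K f w =
    (case w of u # v # r \<Rightarrow> \<Sum>m\<in>UNIV. \<Sum>m'\<in>UNIV. K u v m m' * f (m # m' # r) | _ \<Rightarrow> 0)"

lemma bond_op_simps [simp]:
  "bond_op K f [] = 0" "bond_op K f [u] = 0"
  "bond_op K f (u # v # r) = (\<Sum>m\<in>UNIV. \<Sum>m'\<in>UNIV. K u v m m' * f (m # m' # r))"
  by (simp_all add: bond_op_def)

lemma neutral_add: "neutral n f \<Longrightarrow> neutral n g \<Longrightarrow> neutral n (\<lambda>w. f w + g w)"
  unfolding neutral_def by (metis add.right_neutral)

lemma cyc_sum_add: "cyc_sum n (\<lambda>w. f w + g w) = (\<lambda>w. cyc_sum n f w + cyc_sum n g w)"
  using cyc_sum_lin[of n f 1 g] by simp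

lemma cyc_sum_minus: "cyc_sum n (\<lambda>w. - f w) = (\<lambda>w. - cyc_sum n f w)"
  using cyc_sum_lin[of n "\<lambda>w. 0" "- 1" f] by (simp add: cyc_sum_zero)

text \<open>The four overlaps are: a split pair merged back (\<open>k = 0\<close>), its left half
  merged with the left neighbour (\<open>k = 1\<close>), its right half with the right neighbour
  (\<open>k = n\<close>), and a merged letter split again. For \<open>k = n\<close> the pair of
  sites straddles the end of the word, and an extra \<open>rot\<close> brings it to the
  front.\<close>

lemma bond_op_bond_kernel:
  assumes f: "cyclic n f" and w: "length w = n" "word_spin w = 0" and n: "n \<ge> 2"
  shows "bond_op (bond_kernel \<alpha>) f w =
    merge_first \<alpha> (split_first \<alpha> f) w + merge_first \<alpha> (rot (split_first \<alpha> f)) w +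
    (rot (merge_first \<alpha> ((rot ^^ n) (split_first \<alpha> f))) w + split_first \<alpha> (merge_first \<alpha> f) w)"
proof -
  obtain u v r where uv: "w = u # v # r"
    using w n by (metis One_nat_def Suc_1 Suc_le_length_iff)
  have lr: "n = length r + 2" using w uv by simp
  have 1: "f (e # r @ [s]) = (- 1) ^ length r * letter_sign s * (- f (s # e # r))" for e s
    using cyclic_Cons[OF f, of "e # r" s] lr
    by (simp add: minus_one_power_iff letter_sign_def)
  have A1: "merge_first \<alpha> (rot (split_first \<alpha> f)) w =
      - (\<Sum>m\<in>UNIV. \<Sum>m'\<in>UNIV. (\<Sum>s\<in>UNIV. fusion \<alpha> m s u * fusion \<alpha> s v m') * f (m # m' # r))"
    unfolding uv by (simp add: 1 sum_3 minus_one_power_iff) (simp add: algebra_simps)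
  have rotn: "(rot ^^ n) (split_first \<alpha> f) (s # t # r @ [u]) =
      (- 1) ^ ((n + 1 + 1) * n) * word_sign (s # t # r) * (\<Sum>e\<in>UNIV. fusion \<alpha> u s e * f (e # t # r))" for s t
    using rot_pow_append_eq[of "s # t # r" n "[u]" "n + 1" "split_first \<alpha> f"] by (simp add: lr del: funpow.simps)
  have coef: "fusion \<alpha> s t v * ((- 1) ^ length (v # r) * letter_sign u * ((- 1) ^ ((n + 1 + 1) * n) * word_sign (s # t # r) * X)) =
      - (fusion \<alpha> s t v * X)" for s t X
  proof (cases "fusion \<alpha> s t v = 0")
    case False
    then have "word_sign (s # t # r) = letter_sign v * word_sign r"
      using fusion_sign[of \<alpha> s t v] by simp
    moreover have "letter_sign u * (letter_sign v * word_sign r) = 1"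
      using word_sign_neutral[OF w(2)] by (simp add: uv)
    ultimately have 2: "letter_sign u * word_sign (s # t # r) = 1"
      by (simp only:)
    have 3: "(- 1 :: real) ^ length (v # r) * (- 1) ^ ((n + 1 + 1) * n) = - 1"
      by (simp add: lr minus_one_power_iff)
    have "(- 1) ^ length (v # r) * letter_sign u * ((- 1) ^ ((n + 1 + 1) * n) * word_sign (s # t # r) * X) =
      ((- 1) ^ length (v # r) * (- 1) ^ ((n + 1 + 1) * n)) * (letter_sign u * word_sign (s # t # r)) * X"
      by (simp only: ac_simps)
    then show ?thesis unfolding 2 3 by simp
  qed simp
  have "rot (merge_first \<alpha> ((rot ^^ n) (split_first \<alpha> f))) w =
      (\<Sum>s\<in>UNIV. \<Sum>t\<in>UNIV. fusion \<alpha> s t v * ((- 1) ^ length (v # r) * letter_sign u * ((- 1) ^ ((n + 1 + 1) * n) * word_sign (s # t # r) *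
        (\<Sum>e\<in>UNIV. fusion \<alpha> u s e * f (e # t # r)))))"
    unfolding uv rot_simps append_Cons merge_first_simps rotn by (simp only: sum_distrib_left mult.left_commute)
  also have "\<dots> = - (\<Sum>s\<in>UNIV. \<Sum>t\<in>UNIV. fusion \<alpha> s t v * (\<Sum>e\<in>UNIV. fusion \<alpha> u s e * f (e # t # r)))"
    unfolding coef by (simp only: sum_negf)
  also have "\<dots> = - (\<Sum>m\<in>UNIV. \<Sum>m'\<in>UNIV. (\<Sum>s\<in>UNIV. fusion \<alpha> s m' v * fusion \<alpha> u s m) * f (m # m' # r))"
    unfolding sum_3 by algebra
  finally have An: "rot (merge_first \<alpha> ((rot ^^ n) (split_first \<alpha> f))) w =
    - (\<Sum>m\<in>UNIV. \<Sum>m'\<in>UNIV. (\<Sum>s\<in>UNIV. fusion \<alpha> s m' v * fusion \<alpha> u s m) * f (m # m' # r))" .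
  have A0: "merge_first \<alpha> (split_first \<alpha> f) w =
    (\<Sum>m\<in>UNIV. \<Sum>m'\<in>UNIV. (if v = m' then \<Sum>s\<in>UNIV. \<Sum>t\<in>UNIV. fusion \<alpha> s t u * fusion \<alpha> s t m else 0) * f (m # m' # r))"
    unfolding uv using exhaust_3[of v] by (elim disjE) (simp_all add: sum_3 algebra_simps)
  have SM: "split_first \<alpha> (merge_first \<alpha> f) w =
    (\<Sum>m\<in>UNIV. \<Sum>m'\<in>UNIV. (\<Sum>s\<in>UNIV. fusion \<alpha> u v s * fusion \<alpha> m m' s) * f (m # m' # r))"
    unfolding uv by (simp add: sum_3 algebra_simps)
  show ?thesis
    unfolding A0 A1 An SM unfolding uv bond_op_simps bond_kernel_def
    by (simp only: left_diff_distrib distrib_right sum.distrib sum_subtractf)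
qed

text \<open>\<open>D Q + Q D\<close> vanishes on \<open>f\<close> by assumption; its terms with
  disjoint pairs cancel, and the overlapping ones form the bond sum.\<close>

lemma bond_sum_zero:
  assumes f: "cyclic n f" and n: "n \<ge> 2"
    and split: "cyc_sum (n + 1) (split_first \<alpha> f) = (\<lambda>w. 0)"
    and merge: "cyc_sum (n - 1) (merge_first \<alpha> f) = (\<lambda>w. 0)"
    and loc: "neutral n (bond_op (bond_kernel \<alpha>) f)"
  shows "cyc_sum n (bond_op (bond_kernel \<alpha>) f) = (\<lambda>w. 0)"
proof
  fix w
  have n0: "n > 0" and nn: "Suc (n - 1) = n" using n by simp_all
  have nf: "neutral n f" using f by (simp add: cyclic_def)
  define A where "A k = merge_first \<alpha> ((rot ^^ k) (split_first \<alpha> f))" for k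
  define B where "B k = split_first \<alpha> ((rot ^^ k) (merge_first \<alpha> f))" for k
  have nA: "neutral n (A k)" for k
    unfolding A_def by (intro neutral_merge_first neutral_rot_pow neutral_split_first nf)
  have nB: "neutral n (B k)" for k
    using neutral_split_first[OF neutral_rot_pow[OF neutral_merge_first[of "n - 1" f]]] nf
    unfolding B_def nn by blast
  have "bond_op (bond_kernel \<alpha>) f = (\<lambda>w. A 0 w + A 1 w + (rot (A n) w + B 0 w))"
  proof (rule neutral_eqI[OF loc])
    show "neutral n (\<lambda>w. A 0 w + A 1 w + (rot (A n) w + B 0 w))"
      by (intro neutral_add neutral_rot nA nB)
  qed (simp add: A_def B_def bond_op_bond_kernel[OF f _ _ n])
  then have "cyc_sum n (bond_op (bond_kernel \<alpha>) f) w =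
      cyc_sum n (A 0) w + cyc_sum n (A 1) w + (cyc_sum n (A n) w + cyc_sum n (B 0) w)"
    by (simp add: cyc_sum_add cyc_sum_rot[OF nA n0])
  also have "\<dots> = (\<Sum>k<n + 1. cyc_sum n (A k) w) - (\<Sum>k\<in>{2..<n}. cyc_sum n (A k) w) + cyc_sum n (B 0) w"
  proof -
    have "{..<n + 1} = insert 0 (insert 1 (insert n {2..<n}))" using n by auto
    then show ?thesis using n by simp
  qed
  \<comment> \<open>The disjoint terms of \<open>D Q\<close> match those of \<open>Q D\<close> with
    index \<open>n - k\<close>; the index \<open>0\<close> of \<open>Q D\<close> is the overlapping
    one.\<close>
  also have "(\<Sum>k\<in>{2..<n}. cyc_sum n (A k) w) = - (\<Sum>k\<in>{2..<n}. cyc_sum n (B (n - k)) w)"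
    unfolding sum_negf [symmetric]
  proof (intro sum.cong refl)
    fix k assume k: "k \<in> {2..<n}"
    have "cyc_sum n (A k) = cyc_sum n (\<lambda>w. - (rot ^^ (k - 1)) (B (n - k)) w)"
      using merge_rot_split[OF f, where k = k and \<alpha> = \<alpha>] k by (simp add: A_def B_def)
    then show "cyc_sum n (A k) w = - cyc_sum n (B (n - k)) w"
      unfolding cyc_sum_minus cyc_sum_rot_pow[OF nB n0] by simp
  qed
  also have "(\<Sum>k\<in>{2..<n}. cyc_sum n (B (n - k)) w) = (\<Sum>k\<in>{1..<n - 1}. cyc_sum n (B k) w)"
    by (rule sum.reindex_bij_witness[of _ "\<lambda>k. n - k" "\<lambda>k. n - k"]) auto
  also have "(\<Sum>k<n + 1. cyc_sum n (A k) w) - - (\<Sum>k\<in>{1..<n - 1}. cyc_sum n (B k) w) + cyc_sum n (B 0) w =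
     (\<Sum>k<n + 1. cyc_sum n (A k) w) + (\<Sum>k<n - 1. cyc_sum n (B k) w)"
  proof -
    have "{..<n - 1} = insert 0 {1..<n - 1}" using n by auto
    then show ?thesis by simp
  qed
  also have "(\<Sum>k<n + 1. cyc_sum n (A k) w) = cyc_sum n (merge_first \<alpha> (cyc_sum (n + 1) (split_first \<alpha> f))) w"
    unfolding cyc_sum_def[of "n + 1", abs_def] merge_first_sum cyc_sum_sum A_def ..
  also have "\<dots> = 0"
    unfolding split using cyc_sum_zero[of n] merge_first_sum[of \<alpha> "\<lambda>i w. 0" "{}"] by simp
  also have "(\<Sum>k<n - 1. cyc_sum n (B k) w) = cyc_sum n (split_first \<alpha> (cyc_sum (n - 1) (merge_first \<alpha> f))) w"
    unfolding cyc_sum_def[of "n - 1", abs_def] split_first_sum cyc_sum_sum B_def ..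
  also have "\<dots> = 0"
    unfolding merge using cyc_sum_zero[of n] split_first_sum[of \<alpha> "\<lambda>i w. 0" "{}"] by simp
  finally show "cyc_sum n (bond_op (bond_kernel \<alpha>) f) w = 0" by simp
qed

section \<open>A cycle\<close>

text \<open>Induction on the coordinates: the vectors of \<open>W\<close> vanishing at the new
  coordinate form \<open>W\<close> itself or a hyperplane of \<open>W\<close>, and in the second
  case one Gram-Schmidt step suffices.\<close>

lemma orthogonal_projection:
  fixes W :: "('a \<Rightarrow> real) set"
  assumes "finite \<Omega>" "W \<noteq> {}" "\<And>f g b. f \<in> W \<Longrightarrow> g \<in> W \<Longrightarrow> (\<lambda>x. f x + b * g x) \<in> W"
  shows "\<exists>w\<in>W. \<forall>v\<in>W. (\<Sum>x\<in>\<Omega>. (c x - w x) * v x) = 0"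
  using assms
proof (induction \<Omega> arbitrary: W c)
  case empty
  then show ?case by auto
next
  case (insert o' \<Omega>)
  have zero: "(\<lambda>x. 0) \<in> W"
  proof -
    obtain f where "f \<in> W" using insert.prems by auto
    from insert.prems(2)[OF this this, of "- 1"] show ?thesis by simp
  qed
  define W0 where "W0 = {w \<in> W. w o' = 0}"
  have W0: "W0 \<noteq> {}" "\<And>f g b. f \<in> W0 \<Longrightarrow> g \<in> W0 \<Longrightarrow> (\<lambda>x. f x + b * g x) \<in> W0"
    using zero insert.prems(2) by (auto simp: W0_def)
  let ?ip = "\<lambda>f g. \<Sum>x\<in>insert o' \<Omega>. f x * g x :: real"
  have proj: "\<exists>w\<in>W0. \<forall>v\<in>W0. ?ip (\<lambda>x. c x - w x) v = 0" for c
  proof -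
    obtain w where "w \<in> W0" "\<forall>v\<in>W0. (\<Sum>x\<in>\<Omega>. (c x - w x) * v x) = 0"
      using insert.IH[OF W0] by blast
    then show ?thesis using insert.hyps by (intro bexI[of _ w]) (auto simp: W0_def)
  qed
  show ?case
  proof (cases "W0 = W")
    case True
    then show ?thesis using proj by simp
  next
    case False
    then obtain e where e: "e \<in> W" "e o' \<noteq> 0" by (auto simp: W0_def)
    \<comment> \<open>Subtracting the projection \<open>p\<close> from \<open>e\<close> yields a
      vector \<open>h\<close> orthogonal to \<open>W0\<close> that spans \<open>W\<close> together
      with \<open>W0\<close>.\<close>
    obtain p where p: "p \<in> W0" "\<And>v. v \<in> W0 \<Longrightarrow> ?ip (\<lambda>x. e x - p x) v = 0"
      using proj[of e] by blast
    define h where "h = (\<lambda>x. e x - p x)"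
    have h: "h \<in> W" "h o' \<noteq> 0" "\<And>v. v \<in> W0 \<Longrightarrow> ?ip h v = 0"
      using e p insert.prems(2)[of e p "- 1"] by (auto simp: h_def W0_def)
    have hh: "?ip h h \<noteq> 0"
    proof -
      have "0 < h o' * h o'" using h(2) by (simp add: zero_less_mult_iff) linarith
      also have "\<dots> \<le> ?ip h h" using insert.hyps by (simp add: sum_nonneg)
      finally show ?thesis by simp
    qed
    obtain q where q: "q \<in> W0" "\<And>v. v \<in> W0 \<Longrightarrow> ?ip (\<lambda>x. c x - q x) v = 0"
      using proj[of c] by blast
    define b where "b = ?ip (\<lambda>x. c x - q x) h / ?ip h h"
    define w where "w = (\<lambda>x. q x + b * h x)"
    have "w \<in> W" using insert.prems(2) q h by (auto simp: w_def W0_def)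
    moreover have "?ip (\<lambda>x. c x - w x) v = 0" if "v \<in> W" for v
    proof -
      define t where "t = v o' / h o'"
      define v0 where "v0 = (\<lambda>x. v x + (- t) * h x)"
      have v0: "v0 \<in> W0"
        using insert.prems(2)[OF that h(1), of "- t"] h(2) by (simp add: v0_def W0_def t_def)
      have "?ip (\<lambda>x. c x - w x) v = ?ip (\<lambda>x. c x - q x) v0 + t * ?ip (\<lambda>x. c x - q x) h
          - b * ?ip h v0 - b * t * ?ip h h"
        unfolding sum_distrib_left sum.distrib [symmetric] sum_subtractf [symmetric]
        by (rule sum.cong) (simp_all add: w_def v0_def algebra_simps)
      also have "\<dots> = 0"
        using hh q(2)[OF v0] h(3)[OF v0] by (simp only: b_def) (simp add: field_simps)
      finally show ?thesis .
    qed
    ultimately show ?thesis by blast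
  qed
qed

text \<open>Every \<open>2\<close> contributes \<open>- 1\<close> to the power of the number of letters \<open>\<noteq> 2\<close> preceding it.\<close>

primrec zero_sign :: "3 list \<Rightarrow> real" where
  "zero_sign [] = 1"
| "zero_sign (a # r) = (if a = 2 then 1 else (- 1) ^ count_list r 2) * zero_sign r"

lemma zero_sign_snoc: "zero_sign (r @ [a]) = (if a = 2 then word_sign r else 1) * zero_sign r"
proof (induction r)
  case (Cons b r)
  then show ?case using exhaust_3[of b] by (auto simp: count_list_append)
qed simp

lemma zero_sign_square: "zero_sign w * zero_sign w = 1"
proof (induction w)
  case (Cons a w)
  then show ?case by (simp add: minus_one_power_iff)
qed simp

lemma even_length_iff: "word_spin w = 0 \<Longrightarrow> even (length w) \<longleftrightarrow> even (count_list w 2)"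
proof -
  have "even (length w) \<longleftrightarrow> (even (count_list w 2) \<longleftrightarrow> even (word_spin w))" for w
  proof (induction w)
    case (Cons a w)
    then show ?case using exhaust_3[of a] by auto
  qed simp
  then show "word_spin w = 0 \<Longrightarrow> even (length w) \<longleftrightarrow> even (count_list w 2)" by simp
qed

text \<open>Common form of the cycle and of the odd-length cocycle: up to \<open>zero_sign\<close>,
  the coefficient depends only on the number of letters \<open>2\<close>.\<close>

definition zero_weighted :: "nat \<Rightarrow> (nat \<Rightarrow> real) \<Rightarrow> 3 list \<Rightarrow> real" where
  "zero_weighted n \<kappa> w =
    (if length w = n \<and> word_spin w = 0 then \<kappa> (count_list w 2) * zero_sign w else 0)"

lemma neutral_zero_weighted: "neutral n (zero_weighted n \<kappa>)"
  by (auto simp: neutral_def zero_weighted_def)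

text \<open>For odd \<open>n\<close> the signs of \<open>rot\<close> and \<open>zero_sign\<close>
  match. For even \<open>n\<close>, moving a \<open>2\<close> from the front to the end costs
  \<open>- 1\<close>, so words containing \<open>2\<close> must have weight zero.\<close>

lemma cyclic_zero_weighted:
  assumes "n > 0" "odd n \<or> (\<forall>z>0. \<kappa> z = 0)"
  shows "cyclic n (zero_weighted n \<kappa>)"
  unfolding cyclic_def
proof
  show "neutral n (zero_weighted n \<kappa>)" by (rule neutral_zero_weighted)
  show "rot (zero_weighted n \<kappa>) = zero_weighted n \<kappa>"
  proof (rule neutral_eqI[OF neutral_rot])
    fix w :: "3 list" assume w: "length w = n" "word_spin w = 0"
    then obtain a r where a: "w = a # r" using assms by (cases w) auto
    have par: "even (length w) \<longleftrightarrow> even (count_list w 2)" by (rule even_length_iff[OF w(2)])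
    have ws: "letter_sign a * word_sign r = 1" using word_sign_neutral[OF w(2)] by (simp add: a)
    have *: "zero_weighted n \<kappa> (r @ [a]) = \<kappa> (count_list w 2) * zero_sign (r @ [a])"
      using w by (auto simp: zero_weighted_def a)
    show "rot (zero_weighted n \<kappa>) w = zero_weighted n \<kappa> w"
      using w assms par ws exhaust_3[of a]
      by (auto simp: a * zero_sign_snoc zero_weighted_def minus_one_power_iff)
  qed (rule neutral_zero_weighted)+
qed

text \<open>The weight selects the smallest number of letters \<open>2\<close> that the parity of
  \<open>n\<close> permits at spin zero.\<close>

definition basic_cycle :: "nat \<Rightarrow> 3 list \<Rightarrow> real" where
  "basic_cycle n = zero_weighted n (\<lambda>z. if z = n mod 2 then 1 else 0)"

lemma cyclic_basic_cycle: "n > 0 \<Longrightarrow> cyclic n (basic_cycle n)"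
  unfolding basic_cycle_def by (rule cyclic_zero_weighted) (auto simp: even_iff_mod_2_eq_zero)

text \<open>Rotation moves each letter to the front in turn, so the sum multiplies \<open>e\<close>
  by the total spin, which is zero.\<close>

lemma cyc_sum_spin_head:
  fixes e :: "3 list \<Rightarrow> real"
  assumes e: "cyclic n e" and n: "n > 0"
  shows "cyc_sum n (\<lambda>w. spin (hd w) * e w) = (\<lambda>w. 0)"
proof
  fix w
  show "cyc_sum n (\<lambda>w. spin (hd w) * e w) w = 0"
  proof (cases "length w = n \<and> word_spin w = 0")
    case True
    have "(rot ^^ k) (\<lambda>w. spin (hd w) * e w) w = spin (w ! k) * e w" if k: "k < n" for k
    proof -
      have l: "length (take k w) = k" "length (take k w) + length (drop k w) = n"
        using k True by auto
      have "(rot ^^ k) (\<lambda>w. spin (hd w) * e w) w =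
          (- 1) ^ ((n + 1) * k) * word_sign (take k w) * (spin (w ! k) * e (drop k w @ take k w))"
        using rot_pow_append_eq[OF l n, of "\<lambda>w. spin (hd w) * e w"] k True by (simp add: hd_drop_conv_nth)
      also have "\<dots> = spin (w ! k) * e (take k w @ drop k w)"
        unfolding cyclic_append[OF e l(2) n] l(1) by simp
      finally show ?thesis by simp
    qed
    then have "cyc_sum n (\<lambda>w. spin (hd w) * e w) w = (\<Sum>k<n. real_of_int (spin (w ! k))) * e w"
      by (simp add: cyc_sum_def sum_distrib_right)
    also have "(\<Sum>k<n. real_of_int (spin (w ! k))) = word_spin w"
      using True by (simp add: word_spin_def sum_list_sum_nth atLeast0LessThan)
    finally show ?thesis using True by simp
  next
    case False
    have "neutral n (\<lambda>w. spin (hd w) * e w)"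
      using e by (auto simp: cyclic_def neutral_def)
    then have "neutral n (cyc_sum n (\<lambda>w. spin (hd w) * e w))"
      using cyclic_cyc_sum n by (auto simp: cyclic_def)
    then show ?thesis using False neutral_0 by blast
  qed
qed

text \<open>The merges of \<open>1 3\<close> and \<open>3 1\<close> cancel. For odd
  \<open>n\<close>, absorbing the only \<open>2\<close> leaves \<open>2 * \<alpha>\<close> times the
  spin of the first letter, which \<open>cyc_sum_spin_head\<close> removes.\<close>

lemma merge_basic_cycle:
  assumes "n \<ge> 2"
  shows "cyc_sum (n - 1) (merge_first \<alpha> (basic_cycle n)) = (\<lambda>w. 0)"
proof -
  have nz: "neutral (n - 1) (merge_first \<alpha> (basic_cycle n))"
    using assms neutral_merge_first[of "n - 1" "basic_cycle n"]
    by (simp add: basic_cycle_def neutral_zero_weighted)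
  let ?b = "2 * \<alpha> * (if odd n then 1 else 0)"
  let ?e = "\<lambda>w. spin (hd w) * basic_cycle (n - 1) w"
  have "merge_first \<alpha> (basic_cycle n) = (\<lambda>w. 0 + ?b * ?e w)"
  proof (rule neutral_eqI[OF nz])
    show "neutral (n - 1) (\<lambda>w. 0 + ?b * ?e w)"
      by (auto simp: neutral_def basic_cycle_def zero_weighted_def)
    fix w :: "3 list" assume w: "length w = n - 1" "word_spin w = 0"
    then obtain a r where a: "w = a # r" using assms by (cases w) auto
    have n: "n = Suc (Suc (length r))" using w assms by (simp add: a)
    show "merge_first \<alpha> (basic_cycle n) w = 0 + ?b * ?e w"
      using w(2) exhaust_3[of a]
      by (elim disjE) (simp_all add: a n basic_cycle_def zero_weighted_def sum_3 mod2_eq_if)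
  qed
  then show ?thesis
    using cyc_sum_lin[of "n - 1" "\<lambda>w. 0" ?b ?e] cyc_sum_spin_head[OF cyclic_basic_cycle, of "n - 1"] assms
    by (simp add: cyc_sum_zero)
qed

section \<open>Spin reversal on words\<close>

definition flip_letter :: "3 \<Rightarrow> 3" where
  "flip_letter a = (if a = 1 then 3 else if a = 3 then 1 else 2)"

definition flip :: "(3 list \<Rightarrow> real) \<Rightarrow> 3 list \<Rightarrow> real" where
  "flip f w = f (map flip_letter w)"

lemma flip_letter_simps [simp]: "flip_letter 1 = 3" "flip_letter 2 = 2" "flip_letter 3 = 1"
  by (simp_all add: flip_letter_def)

lemma flip_letter_flip_letter [simp]: "flip_letter (flip_letter a) = a"
  using exhaust_3[of a] by auto

lemma map_flip_letter [simp]: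
  "map flip_letter (map flip_letter w) = w" "word_sign (map flip_letter w) = word_sign w"
  "word_spin (map flip_letter w) = - word_spin w" "count_list (map flip_letter w) 2 = count_list w 2"
  "zero_sign (map flip_letter w) = zero_sign w"
proof -
  show "map flip_letter (map flip_letter w) = w" by (induction w) auto
  have [simp]: "letter_sign (flip_letter a) = letter_sign a" "spin (flip_letter a) = - spin a"
    "flip_letter a = 2 \<longleftrightarrow> a = 2" for a
    using exhaust_3[of a] by auto
  show "word_sign (map flip_letter w) = word_sign w" by (induction w) auto
  show "word_spin (map flip_letter w) = - word_spin w" by (induction w) auto
  show c: "count_list (map flip_letter w) 2 = count_list w 2" for w by (induction w) auto
  show "zero_sign (map flip_letter w) = zero_sign w" by (induction w) (auto simp: c)
qed

lemma pairing_flip: "pairing n (flip f) (flip g) = pairing n f g"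
  unfolding pairing_def flip_def
  by (rule sum.reindex_bij_witness[of _ "map flip_letter" "map flip_letter"]) (auto simp: words_def simp del: map_map)

lemma rot_flip: "rot (flip f) = flip (rot f)"
proof
  fix w show "rot (flip f) w = flip (rot f) w"
  proof (cases w)
    case (Cons a r)
    then show ?thesis using exhaust_3[of a] by (auto simp: flip_def)
  qed (simp add: flip_def)
qed

lemma cyc_sum_flip: "cyc_sum n (flip f) = flip (cyc_sum n f)"
proof -
  have "(rot ^^ k) (flip f) = flip ((rot ^^ k) f)" for k
    by (induction k) (simp_all add: rot_flip)
  then show ?thesis by (auto simp: cyc_sum_def flip_def fun_eq_iff)
qed

lemma neutral_flip: "neutral n f \<Longrightarrow> neutral n (flip f)"
  unfolding neutral_def flip_def by (metis length_map map_flip_letter(3) neg_equal_0_iff_equal)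

text \<open>Exchanging \<open>1\<close> and \<open>3\<close> negates every structure constant, so
  spin reversal preserves the kernels of \<open>Q\<close> and \<open>D\<close>.\<close>

lemma split_first_flip: "split_first \<alpha> (flip f) w = - flip (split_first \<alpha> f) w"
proof (cases "length w \<ge> 2")
  case True
  then obtain u v r where "w = u # v # r" by (metis Suc_1 Suc_le_length_iff One_nat_def)
  then show ?thesis
    using exhaust_3[of u] exhaust_3[of v] by (elim disjE) (simp_all add: flip_def sum_3)
next
  case False
  then have "w = [] \<or> (\<exists>u. w = [u])" by (cases w; cases "tl w") auto
  then show ?thesis by (auto simp: flip_def)
qed

lemma merge_first_flip: "merge_first \<alpha> (flip f) w = - flip (merge_first \<alpha> f) w"
proof (cases w)
  case (Cons a r)
  then show ?thesis
    using exhaust_3[of a] by (elim disjE) (simp_all add: flip_def sum_3)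
qed (simp add: flip_def)

section \<open>A dual cocycle and the singlet\<close>

text \<open>For cyclic \<open>d\<close> and \<open>n > 0\<close>, adjointness makes this equivalent
  to \<open>Q d = 0\<close>; the form tested on the image of \<open>D\<close> is the one used for
  non-vanishing.\<close>

definition cocycle :: "real \<Rightarrow> nat \<Rightarrow> (3 list \<Rightarrow> real) \<Rightarrow> bool" where
  "cocycle \<alpha> n d \<longleftrightarrow>
    (\<forall>\<psi>. cyclic (n + 1) \<psi> \<longrightarrow> pairing n (cyc_sum n (merge_first \<alpha> \<psi>)) d = 0)"

text \<open>\<open>split_first\<close> sends the vector to a difference \<open>g - rot g\<close>,
  which is orthogonal to every rotation-invariant \<open>\<psi>\<close>.\<close>

lemma odd_cocycle:
  assumes n: "odd n"
  shows "cocycle \<alpha> n (zero_weighted n (\<lambda>z. (2 * \<alpha>) ^ (z div 2)))" (is "cocycle \<alpha> n ?d")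
  unfolding cocycle_def
proof (intro allI impI)
  fix \<psi> assume \<psi>: "cyclic (n + 1) \<psi>"
  obtain m where m: "n = m + 1" using n by (cases n) auto
  have "cyclic n ?d" using cyclic_zero_weighted n by (auto simp: m)
  \<comment> \<open>A split into \<open>1 3\<close> or \<open>3 1\<close> gets one half from
    \<open>g\<close> and one half from \<open>rot g\<close>; a split producing a further
    \<open>2\<close> has coefficient \<open>\<alpha>\<close> up to sign, which is one half of the
    weight ratio \<open>2 * \<alpha>\<close>.\<close>
  define g where "g w = (if length w = n + 1 \<and> word_spin w = 0
    then spin (hd w) / 2 * (2 * \<alpha>) ^ (count_list w 2 div 2) * zero_sign w else 0)" for w
  have ng: "neutral (n + 1) g" by (auto simp: neutral_def g_def)
  have "split_first \<alpha> ?d = (\<lambda>w. g w + (- 1) * rot g w)"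
  proof (rule neutral_eqI)
    show "neutral (n + 1) (split_first \<alpha> ?d)"
      using neutral_split_first[OF neutral_zero_weighted] by simp
    show "neutral (n + 1) (\<lambda>w. g w + (- 1) * rot g w)"
      using ng neutral_rot[OF ng] unfolding neutral_def by (metis add.right_neutral mult_zero_right)
    fix w :: "3 list" assume w: "length w = n + 1" "word_spin w = 0"
    then obtain u v r where uv: "w = u # v # r"
      by (metis Suc_eq_plus1 length_Suc_conv m)
    have par: "even (count_list w 2)" using even_length_iff[OF w(2)] w n by simp
    have ws: "letter_sign u * (letter_sign v * word_sign r) = 1"
      using word_sign_neutral[OF w(2)] by (simp add: uv)
    have lr: "n = Suc (length r)" "odd (Suc (length r))" using w n by (simp_all add: uv)
    show "split_first \<alpha> ?d w = g w + (- 1) * rot g w"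
      using exhaust_3[of u] exhaust_3[of v]
    proof (elim disjE)
    qed (use w(2) par ws lr(2) in \<open>auto simp: uv g_def zero_weighted_def sum_3 zero_sign_snoc
        count_list_append lr(1) minus_one_power_iff elim!: oddE\<close>)
  qed
  then have "pairing (n + 1) (split_first \<alpha> ?d) \<psi> = pairing (n + 1) g \<psi> - pairing (n + 1) (rot g) \<psi>"
    using pairing_lin[of "n + 1" g "- 1" "rot g" \<psi>] by simp
  also have "\<dots> = 0"
    using pairing_rot[of "n + 1" g \<psi>] \<psi> by (simp add: cyclic_def)
  finally have "pairing n ?d (merge_first \<alpha> \<psi>) = 0"
    using pairing_split_first[of m \<alpha> ?d \<psi>] by (simp add: m)
  then show "pairing n (cyc_sum n (merge_first \<alpha> \<psi>)) ?d = 0"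
    using pairing_cyc_sum[OF \<open>cyclic n ?d\<close>] by (simp add: m pairing_commute)
qed

section \<open>Alternating words and the even-length cocycle\<close>

definition alternating :: "nat \<Rightarrow> 3 list" where
  "alternating n = concat (replicate n [1, 3])"

definition alternating' :: "nat \<Rightarrow> 3 list" where
  "alternating' n = concat (replicate n [3, 1])"

lemma alternating_Suc [simp]:
  "alternating 0 = []" "alternating (Suc n) = 1 # 3 # alternating n"
  "alternating' 0 = []" "alternating' (Suc n) = 3 # 1 # alternating' n"
  by (simp_all add: alternating_def alternating'_def)

lemma alternating_snoc [simp]:
  "alternating n @ [1] = 1 # alternating' n" "alternating' n @ [3] = 3 # alternating n"
  by (induction n) simp_all

lemma alternating_props [simp]:
  "length (alternating n) = 2 * n" "length (alternating' n) = 2 * n"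
  "word_spin (alternating n) = 0" "word_spin (alternating' n) = 0"
  "count_list (alternating n) 2 = 0" "count_list (alternating' n) 2 = 0"
  "zero_sign (alternating n) = 1" "zero_sign (alternating' n) = 1"
  "map flip_letter (alternating n) = alternating' n" "map flip_letter (alternating' n) = alternating n"
  by (induction n) simp_all

definition alternating_vector :: "nat \<Rightarrow> 3 list \<Rightarrow> real" where
  "alternating_vector n w = of_bool (w = alternating n) + of_bool (w = alternating' n)"

lemma pairing_alternating_vector:
  "pairing (2 * n) f (alternating_vector n) = f (alternating n) + f (alternating' n)"
  by (simp add: pairing_def alternating_vector_def words_def distrib_left sum.distrib
      finite_words[unfolded words_def] of_bool_def if_distrib[of "(*) _"] sum.delta cong: if_cong)

text \<open>Only words with a single \<open>2\<close> merge into an alternating word. Rotation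
  identifies the four contributions in two pairs of opposite sign.\<close>

lemma even_cocycle:
  assumes n: "n > 0"
  shows "cocycle \<alpha> (2 * n) (alternating_vector n)"
  unfolding cocycle_def
proof (intro allI impI)
  fix \<psi> assume \<psi>: "cyclic (2 * n + 1) \<psi>"
  obtain m where m: "n = Suc m" using n by (cases n) auto
  let ?L = "\<lambda>f. f (alternating n) + f (alternating' n) :: real"
  \<comment> \<open>The rotation exchanges the two alternating words; its sign
    \<open>(- 1) ^ (2 * n - 1)\<close> cancels the letter sign \<open>- 1\<close>.\<close>
  have "?L (rot f) = ?L f" for f by (simp add: m)
  then have "?L ((rot ^^ k) f) = ?L f" for k f
    by (induction k) simp_all
  then have "(\<Sum>k<2 * n. ?L ((rot ^^ k) f)) = 2 * n * ?L f" for f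
    by simp
  then have L: "?L (cyc_sum (2 * n) f) = 2 * n * ?L f" for f
    by (simp add: cyc_sum_def sum.distrib)
  have "\<psi> (1 # 2 # 3 # alternating m) = - \<psi> (2 # 3 # 1 # alternating' m)"
    using cyclic_Cons[OF \<psi>, of "2 # 3 # alternating m" 1] by (simp add: m)
  moreover have "\<psi> (3 # 2 # 1 # alternating' m) = - \<psi> (2 # 1 # 3 # alternating m)"
    using cyclic_Cons[OF \<psi>, of "2 # 1 # alternating' m" 3] by (simp add: m)
  ultimately have "?L (merge_first \<alpha> \<psi>) = 0"
    by (simp add: m sum_3)
  then show "pairing (2 * n) (cyc_sum (2 * n) (merge_first \<alpha> \<psi>)) (alternating_vector n) = 0"
    unfolding pairing_alternating_vector L by simp
qed

lemma exists_cocycle: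
  assumes n: "n \<ge> 2"
  shows "\<exists>d. cocycle \<alpha> n d \<and> pairing n (basic_cycle n) d > 0 \<and> flip d = d"
proof (cases "even n")
  case True
  then obtain m where m: "n = 2 * m" by (elim evenE)
  have "flip (alternating_vector m) w = alternating_vector m w" for w
  proof -
    have "map flip_letter w = alternating m \<longleftrightarrow> w = alternating' m"
      "map flip_letter w = alternating' m \<longleftrightarrow> w = alternating m"
      by (metis map_flip_letter(1) alternating_props(9,10))+
    then show ?thesis by (simp add: alternating_vector_def flip_def)
  qed
  moreover have "pairing n (basic_cycle n) (alternating_vector m) > 0"
    unfolding m pairing_alternating_vector by (simp add: basic_cycle_def zero_weighted_def)
  ultimately show ?thesis
    using even_cocycle[of m \<alpha>] n by (intro exI[of _ "alternating_vector m"]) (simp add: m fun_eq_iff)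
next
  case False
  then obtain m where m: "n = Suc (2 * m)" by (elim oddE) simp
  let ?d = "zero_weighted n (\<lambda>z. (2 * \<alpha>) ^ (z div 2))"
  \<comment> \<open>Both vectors carry the same \<open>zero_sign\<close>, which squares to
    \<open>1\<close>. A single \<open>2\<close> has cocycle weight
    \<open>(2 * \<alpha>) ^ 0 = 1\<close>, so positivity persists at
    \<open>\<alpha> = 0\<close>.\<close>
  have pos: "basic_cycle n w * ?d w \<ge> 0" for w
    by (auto simp: basic_cycle_def zero_weighted_def m zero_sign_square)
  have "0 < basic_cycle n (2 # alternating m) * ?d (2 # alternating m)"
    by (simp add: basic_cycle_def zero_weighted_def m)
  then have "pairing n (basic_cycle n) ?d > 0"
    unfolding pairing_def by (intro sum_pos2[of _ "2 # alternating m"] pos) (simp_all add: m words_def finite_words[unfolded words_def])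
  moreover have "flip ?d = ?d"
    by (simp add: fun_eq_iff flip_def zero_weighted_def)
  ultimately show ?thesis using odd_cocycle[OF False] by blast
qed

text \<open>The harmonic representative is \<open>basic_cycle\<close> minus its orthogonal
  projection onto the image of \<open>D\<close>, symmetrised under spin reversal.\<close>

lemma supersymmetry_singlet:
  assumes n: "n \<ge> 2"
  shows "\<exists>f. cyclic n f \<and> f \<noteq> (\<lambda>w. 0) \<and> flip f = f \<and>
    cyc_sum (n + 1) (split_first \<alpha> f) = (\<lambda>w. 0) \<and> cyc_sum (n - 1) (merge_first \<alpha> f) = (\<lambda>w. 0)"
proof -
  have n0: "n > 0" and n1: "n = n - 2 + 1 + 1" using n by simp_all
  obtain d where d: "cocycle \<alpha> n d" "pairing n (basic_cycle n) d > 0" "flip d = d"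
    using exists_cocycle[OF n] by blast
  define D where "D \<psi> = cyc_sum n (merge_first \<alpha> \<psi>)" for \<psi>
  define W where "W = D ` {\<psi>. cyclic (n + 1) \<psi>}"
  have lin: "cyclic k (\<lambda>w. f w + b * g w)" if "cyclic k f" "cyclic k g" for k f g b
    using that unfolding cyclic_def neutral_def rot_lin by (auto simp: fun_eq_iff) (metis add_0 mult_zero_right)+
  have zero: "cyclic k (\<lambda>w. 0)" for k
    using rot_sum[of "\<lambda>i w. 0" "{}"] by (simp add: cyclic_def neutral_def)
  have "\<exists>w\<in>W. \<forall>v\<in>W. (\<Sum>x\<in>words n. (basic_cycle n x - w x) * v x) = 0"
  proof (rule orthogonal_projection)
    fix f g b assume "f \<in> W" "g \<in> W"
    then obtain \<psi> \<psi>' where "f = D \<psi>" "g = D \<psi>'" "cyclic (n + 1) \<psi>" "cyclic (n + 1) \<psi>'"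
      by (auto simp: W_def)
    then show "(\<lambda>x. f x + b * g x) \<in> W"
      unfolding W_def by (intro image_eqI[of _ _ "\<lambda>w. \<psi> w + b * \<psi>' w"])
        (simp_all add: D_def merge_first_lin cyc_sum_lin lin)
  qed (use zero in \<open>auto simp: W_def\<close>)
  then obtain \<psi> where \<psi>: "cyclic (n + 1) \<psi>"
    and orth: "\<And>\<psi>'. cyclic (n + 1) \<psi>' \<Longrightarrow> (\<Sum>x\<in>words n. (basic_cycle n x - D \<psi> x) * D \<psi>' x) = 0"
    by (auto simp: W_def)
  define \<xi> where "\<xi> = (\<lambda>w. basic_cycle n w + (- 1) * D \<psi> w)"
  have "neutral n (merge_first \<alpha> \<psi>)"
    using \<psi> neutral_merge_first by (simp add: cyclic_def)
  then have \<xi>: "cyclic n \<xi>"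
    unfolding \<xi>_def D_def by (intro lin cyclic_basic_cycle cyclic_cyc_sum n0)
  then have n\<xi>: "neutral n \<xi>" by (simp add: cyclic_def)
  have merge: "cyc_sum (n - 1) (merge_first \<alpha> \<xi>) = (\<lambda>w. 0)"
    using merge_square_zero[OF \<psi>, of \<alpha>] n
    unfolding \<xi>_def merge_first_lin cyc_sum_lin merge_basic_cycle[OF n] D_def by simp
  define Q where "Q = cyc_sum (n + 1) (split_first \<alpha> \<xi>)"
  have cQ: "cyclic (n + 1) Q"
    unfolding Q_def using cyclic_cyc_sum[OF neutral_split_first[OF n\<xi>]] by simp
  \<comment> \<open>By adjointness the squared norm of \<open>Q\<close> is a multiple of the pairing
    of \<open>\<xi>\<close> with \<open>D Q\<close>, and \<open>\<xi>\<close> is orthogonal to the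
    image of \<open>D\<close>.\<close>
  have "pairing (n + 1) Q Q = (n + 1) * pairing (n + 1) (split_first \<alpha> \<xi>) Q"
    unfolding Q_def by (rule pairing_cyc_sum) (use cQ in \<open>simp_all add: Q_def\<close>)
  also have "pairing (n + 1) (split_first \<alpha> \<xi>) Q = pairing n \<xi> (merge_first \<alpha> Q)"
    using pairing_split_first[of "n - 2 + 1" \<alpha> \<xi> Q] n1 by simp
  also have "\<dots> = 0"
  proof -
    have "n * pairing n (merge_first \<alpha> Q) \<xi> = pairing n (D Q) \<xi>"
      unfolding D_def using pairing_cyc_sum[OF \<xi> n0] by simp
    also have "\<dots> = 0"
      using orth[OF cQ] by (simp add: pairing_def \<xi>_def mult.commute)
    finally show ?thesis using n0 by (simp add: pairing_commute)
  qed
  finally have "\<forall>w\<in>words (n + 1). Q w * Q w = 0"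
    unfolding pairing_def by (subst sum_nonneg_eq_0_iff [symmetric]) simp_all
  then have split: "Q = (\<lambda>w. 0)"
    using cQ by (auto simp: cyclic_def neutral_def words_def fun_eq_iff)
  have "pairing n \<xi> d = pairing n (basic_cycle n) d - pairing n (D \<psi>) d"
    using pairing_lin[of n "basic_cycle n" "- 1" "D \<psi>" d] by (simp add: \<xi>_def)
  also have "\<dots> > 0" using d(1,2) \<psi> by (simp add: cocycle_def D_def)
  finally have pos: "pairing n \<xi> d > 0" .
  \<comment> \<open>Symmetrising does not destroy the vector: since \<open>flip d = d\<close>, both
    summands have the same positive pairing with \<open>d\<close>.\<close>
  define f where "f = (\<lambda>w. \<xi> w + 1 * flip \<xi> w)"
  have "cyclic n (flip \<xi>)"
    using \<xi> neutral_flip by (simp add: cyclic_def rot_flip)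
  then have "cyclic n f" unfolding f_def by (intro lin \<xi>)
  moreover have "flip f = f"
    by (simp add: f_def flip_def fun_eq_iff add.commute del: map_map)
  moreover have "f \<noteq> (\<lambda>w. 0)"
  proof
    assume "f = (\<lambda>w. 0)"
    then have "pairing n \<xi> d + pairing n (flip \<xi>) d = 0"
      using pairing_lin[of n \<xi> 1 "flip \<xi>" d] unfolding f_def [symmetric] by (simp add: pairing_def)
    then show False using pairing_flip[of n \<xi> d] d(3) pos by simp
  qed
  moreover have flips: "split_first \<alpha> (flip \<xi>) = (\<lambda>w. - flip (split_first \<alpha> \<xi>) w)"
    "merge_first \<alpha> (flip \<xi>) = (\<lambda>w. - flip (merge_first \<alpha> \<xi>) w)"
    using split_first_flip merge_first_flip by blast+
  have "cyc_sum (n + 1) (split_first \<alpha> f) = (\<lambda>w. 0)" "cyc_sum (n - 1) (merge_first \<alpha> f) = (\<lambda>w. 0)"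
    unfolding f_def split_first_lin merge_first_lin cyc_sum_lin flips cyc_sum_minus cyc_sum_flip
      merge split[unfolded Q_def] by (simp_all add: flip_def)
  ultimately show ?thesis by blast
qed

section \<open>Comparison with the Hamiltonian\<close>

lemma spin_matrix_nth [simp]:
  "spin_matrix 1 $ 1 $ 1 = 0" "spin_matrix 1 $ 1 $ 2 = 1 / sqrt 2" "spin_matrix 1 $ 1 $ 3 = 0"
  "spin_matrix 1 $ 2 $ 1 = 1 / sqrt 2" "spin_matrix 1 $ 2 $ 2 = 0" "spin_matrix 1 $ 2 $ 3 = 1 / sqrt 2"
  "spin_matrix 1 $ 3 $ 1 = 0" "spin_matrix 1 $ 3 $ 2 = 1 / sqrt 2" "spin_matrix 1 $ 3 $ 3 = 0"
  "spin_matrix 2 $ 1 $ 1 = 0" "spin_matrix 2 $ 1 $ 2 = - \<i> * (1 / sqrt 2)" "spin_matrix 2 $ 1 $ 3 = 0"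
  "spin_matrix 2 $ 2 $ 1 = \<i> * (1 / sqrt 2)" "spin_matrix 2 $ 2 $ 2 = 0" "spin_matrix 2 $ 2 $ 3 = - \<i> * (1 / sqrt 2)"
  "spin_matrix 2 $ 3 $ 1 = 0" "spin_matrix 2 $ 3 $ 2 = \<i> * (1 / sqrt 2)" "spin_matrix 2 $ 3 $ 3 = 0"
  "spin_matrix 3 $ u $ v = (if u = v then of_int (spin u) else 0)"
proof -
  show "spin_matrix 3 $ u $ v = (if u = v then of_int (spin u) else 0)"
    using exhaust_3[of u] exhaust_3[of v] by (auto simp: spin_matrix_def vector_3)
qed (simp_all add: spin_matrix_def vector_3, simp_all add: scaleR_conv_of_real)

lemma sqrt_2_mult_sqrt_2:
  "complex_of_real (sqrt 2) * complex_of_real (sqrt 2) = 2"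
  "complex_of_real (sqrt 2) * (complex_of_real (sqrt 2) * z) = 2 * z"
proof -
  show *: "complex_of_real (sqrt 2) * complex_of_real (sqrt 2) = 2"
    by (simp flip: of_real_mult)
  show "complex_of_real (sqrt 2) * (complex_of_real (sqrt 2) * z) = 2 * z"
    using * by (metis mult.assoc)
qed

definition spin_product :: "3 \<Rightarrow> 3 \<Rightarrow> 3 \<Rightarrow> 3 \<Rightarrow> complex" where
  "spin_product a b u m = (\<Sum>p\<in>UNIV. spin_matrix a $ u $ p * spin_matrix b $ p $ m)"

text \<open>Matrix element of one bond of the Hamiltonian, from \<open>m m'\<close> to
  \<open>u v\<close>. The squares of the spin matrices act on the first site of the bond
  only.\<close>

definition spin_kernel :: "real \<Rightarrow> 3 \<Rightarrow> 3 \<Rightarrow> 3 \<Rightarrow> 3 \<Rightarrow> complex" where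
  "spin_kernel x u v m m' =
    (\<Sum>a\<in>UNIV. of_real (coupling_J x a) *
      (spin_matrix a $ u $ m * spin_matrix a $ v $ m' + 2 * (if v = m' then spin_product a a u m else 0)))
    - (\<Sum>a\<in>UNIV. \<Sum>b\<in>UNIV. of_real (coupling_A x a b) * (spin_product a b u m * spin_product a b v m'))"

text \<open>A one-site term, shifted along the bond, cancels in the sum over all sites.\<close>

definition site_energy :: "real \<Rightarrow> 3 \<Rightarrow> real" where
  "site_energy x u = (if u = 2 then 1 - x\<^sup>2 / 4 else 0)"

definition real_kernel :: "real \<Rightarrow> 3 \<Rightarrow> 3 \<Rightarrow> 3 \<Rightarrow> 3 \<Rightarrow> real" where
  "real_kernel x u v m m' = bond_kernel (- x / 2) u v m m' +
    (if u = m \<and> v = m' then site_energy x u - site_energy x v else 0)"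

lemma bond_kernel_spin: "bond_kernel \<alpha> u v m m' \<noteq> 0 \<Longrightarrow> spin m + spin m' = spin u + spin v"
  using exhaust_3[of u] exhaust_3[of v] exhaust_3[of m] exhaust_3[of m']
  by (elim disjE) (simp_all add: bond_kernel_def sum_3)

lemma spin_product_simps:
  "spin_product a b 1 1 = (if a = 3 \<and> b = 3 then 1 else if a = 3 \<or> b = 3 then 0
     else if a = b then 1 / 2 else if a = 1 then \<i> / 2 else - \<i> / 2)"
  "spin_product a b 3 3 = (if a = 3 \<and> b = 3 then 1 else if a = 3 \<or> b = 3 then 0
     else if a = b then 1 / 2 else if a = 1 then - \<i> / 2 else \<i> / 2)"
  "spin_product a b 2 2 = (if a = 3 \<or> b = 3 \<or> a \<noteq> b then 0 else 1)"
  "spin_product a b 1 3 = (if a = 3 \<or> b = 3 then 0 else if a \<noteq> b then - \<i> / 2 else if a = 1 then 1 / 2 else - 1 / 2)"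
  "spin_product a b 3 1 = (if a = 3 \<or> b = 3 then 0 else if a \<noteq> b then \<i> / 2 else if a = 1 then 1 / 2 else - 1 / 2)"
  "spin_product a b 1 2 = (if a = 3 then spin_matrix b $ 1 $ 2 else 0)"
  "spin_product a b 3 2 = (if a = 3 then - spin_matrix b $ 3 $ 2 else 0)"
  "spin_product a b 2 1 = (if b = 3 then spin_matrix a $ 2 $ 1 else 0)"
  "spin_product a b 2 3 = (if b = 3 then - spin_matrix a $ 2 $ 3 else 0)"
  using exhaust_3[of a] exhaust_3[of b]
  by (auto simp: spin_product_def sum_3 field_simps sqrt_2_mult_sqrt_2)

text \<open>The local link between Hamiltonian and supersymmetry at
  \<open>\<alpha> = - x / 2\<close>, verified on all 81 matrix elements.\<close>

lemma spin_kernel_eq: "spin_kernel x u v m m' = of_real (real_kernel x u v m m')"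
  using exhaust_3[of u] exhaust_3[of v] exhaust_3[of m] exhaust_3[of m']
  by (elim disjE; hypsubst; simp add: spin_kernel_def real_kernel_def site_energy_def bond_kernel_def
      sum_3 coupling_J_def coupling_A_def spin_product_simps; simp add: field_simps sqrt_2_mult_sqrt_2 power2_eq_square)

lemma neutral_bond_op:
  assumes f: "neutral n f"
    and K: "\<And>u v m m'. K u v m m' \<noteq> 0 \<Longrightarrow> spin m + spin m' = spin u + spin v"
  shows "neutral n (bond_op K f)"
  unfolding neutral_def
proof (intro allI impI)
  fix w assume nz: "bond_op K f w \<noteq> 0"
  then obtain u v r where w: "w = u # v # r"
    by (metis bond_op_simps(1,2) neq_Nil_conv)
  then obtain m m' where "K u v m m' * f (m # m' # r) \<noteq> 0"
    using nz by (metis (no_types, lifting) bond_op_simps(3) sum.neutral)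
  then show "length w = n \<and> word_spin w = 0"
    using f K[of u v m m'] by (auto simp: neutral_def w)
qed

lemma cyc_sum_real_kernel:
  assumes f: "cyclic n f" and n: "n \<ge> 2"
  shows "cyc_sum n (bond_op (real_kernel x) f) = cyc_sum n (bond_op (bond_kernel (- x / 2)) f)"
proof -
  have nf: "neutral n f" using f by (simp add: cyclic_def)
  define e where "e w = site_energy x (hd w) * f w" for w
  have ne: "neutral n e" using nf by (auto simp: neutral_def e_def)
  have nk: "neutral n (bond_op (bond_kernel (- x / 2)) f)"
    by (rule neutral_bond_op[OF nf bond_kernel_spin])
  have "bond_op (real_kernel x) f =
    (\<lambda>w. bond_op (bond_kernel (- x / 2)) f w + 1 * (e w + (- 1) * rot e w))"
  proof (rule neutral_eqI)
    show "neutral n (bond_op (real_kernel x) f)"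
      by (rule neutral_bond_op[OF nf]) (use bond_kernel_spin in \<open>auto simp: real_kernel_def split: if_splits\<close>)
    show "neutral n (\<lambda>w. bond_op (bond_kernel (- x / 2)) f w + 1 * (e w + (- 1) * rot e w))"
      using nk ne neutral_rot[OF ne] unfolding neutral_def
      by (metis add.right_neutral mult_zero_right)
    fix w :: "3 list" assume w: "length w = n"
    then obtain u v r where uv: "w = u # v # r"
      using n by (metis One_nat_def Suc_1 Suc_le_length_iff)
    \<comment> \<open>Rotation brings the second letter \<open>v\<close> to the front, and cyclicity
      of \<open>f\<close> absorbs the sign.\<close>
    have "rot e w = site_energy x v * f w"
      using cyclic_Cons[OF f, of "v # r" u] w by (simp add: uv e_def)
    moreover have "bond_op (real_kernel x) f w =
        bond_op (bond_kernel (- x / 2)) f w + (site_energy x u - site_energy x v) * f w"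
      using exhaust_3[of u] exhaust_3[of v]
      by (elim disjE) (simp_all add: uv real_kernel_def sum_3 algebra_simps)
    ultimately show "bond_op (real_kernel x) f w =
        bond_op (bond_kernel (- x / 2)) f w + 1 * (e w + (- 1) * rot e w)"
      by (simp add: e_def uv algebra_simps)
  qed
  then show ?thesis
    using n by (simp only: cyc_sum_lin cyc_sum_rot[OF ne]) simp
qed

section \<open>Products of one-site operators on one and two sites\<close>

lemma site_op_comp:
  assumes "i < length c"
  shows "site_op A (Suc i) (site_op B (Suc i) \<psi>) c = site_op (A ** B) (Suc i) \<psi> c"
proof -
  have "site_op A (Suc i) (site_op B (Suc i) \<psi>) c =
      (\<Sum>p\<in>UNIV. \<Sum>m\<in>UNIV. A $ (c ! i) $ p * B $ p $ m * \<psi> (c[i := m]))"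
    using assms by (simp add: site_op_def sum_distrib_left mult.assoc)
  also have "\<dots> = (\<Sum>m\<in>UNIV. \<Sum>p\<in>UNIV. A $ (c ! i) $ p * B $ p $ m * \<psi> (c[i := m]))"
    by (rule sum.swap)
  also have "\<dots> = site_op (A ** B) (Suc i) \<psi> c"
    by (simp add: site_op_def matrix_matrix_mult_def sum_distrib_right)
  finally show ?thesis .
qed

lemma site_op_pair:
  assumes "i < length c" "k < length c" "i \<noteq> k"
  shows "site_op A (Suc i) (site_op B (Suc k) \<psi>) c =
    (\<Sum>m\<in>UNIV. \<Sum>m'\<in>UNIV. A $ (c ! i) $ m * B $ (c ! k) $ m' * \<psi> (c[i := m, k := m']))"
  using assms by (simp add: site_op_def sum_distrib_left mult.assoc)

lemma site_op_quadruple: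
  assumes "i < length c" "k < length c" "i \<noteq> k"
  shows "(site_op A (Suc i) \<circ> site_op B (Suc i) \<circ> site_op C (Suc k) \<circ> site_op D (Suc k)) \<psi> c =
    (\<Sum>m\<in>UNIV. \<Sum>m'\<in>UNIV. (A ** B) $ (c ! i) $ m * (C ** D) $ (c ! k) $ m' * \<psi> (c[i := m, k := m']))"
proof -
  have "(site_op A (Suc i) \<circ> site_op B (Suc i) \<circ> site_op C (Suc k) \<circ> site_op D (Suc k)) \<psi> c =
      site_op (A ** B) (Suc i) (site_op C (Suc k) (site_op D (Suc k) \<psi>)) c"
    using assms by (simp add: site_op_comp)
  also have "\<dots> = site_op (A ** B) (Suc i) (site_op (C ** D) (Suc k) \<psi>) c"
    using assms(2) by (simp only: site_op_def[of "A ** B"]) (simp add: site_op_comp)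
  finally show ?thesis using site_op_pair[OF assms] by simp
qed

definition twist :: "3 \<Rightarrow> complex" where
  "twist a = (if a = 3 then 1 else - 1)"

lemma spin_op_twisted: "spin_op N a (N + 1) = site_op (\<chi> u m. twist a * spin_matrix a $ u $ m) (Suc 0)"
  by (auto simp: spin_op_def site_op_def twist_def fun_eq_iff sum_negf)

text \<open>The diagonal twist is conjugation by the diagonal matrix of letter signs, the same signs
  as in \<open>rot\<close>.\<close>

lemma twisted_spin_matrix:
  "twist a * spin_matrix a $ u $ m = of_real (letter_sign u * letter_sign m) * spin_matrix a $ u $ m"
  using exhaust_3[of a] exhaust_3[of u] exhaust_3[of m]
  by (elim disjE) (simp_all add: twist_def)

lemma sum_bilinear:
  fixes g :: "'a \<Rightarrow> complex"
  shows "(\<Sum>a\<in>A. g a * ((\<Sum>m\<in>M. \<Sum>m'\<in>M'. X a m m') + 2 * (\<Sum>m\<in>M. \<Sum>m'\<in>M'. Y a m m'))) =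
    (\<Sum>m\<in>M. \<Sum>m'\<in>M'. \<Sum>a\<in>A. g a * (X a m m' + 2 * Y a m m'))"
  by (subst sum_swap3) (simp only: sum_distrib_left sum.distrib distrib_left)

lemma sum_biquadratic:
  fixes h :: "'a \<Rightarrow> 'b \<Rightarrow> complex"
  shows "(\<Sum>a\<in>A. \<Sum>b\<in>B. h a b * (\<Sum>m\<in>M. \<Sum>m'\<in>M'. R a b m m')) =
    (\<Sum>m\<in>M. \<Sum>m'\<in>M'. \<Sum>a\<in>A. \<Sum>b\<in>B. h a b * R a b m m')"
proof -
  have "(\<Sum>m\<in>M. \<Sum>m'\<in>M'. \<Sum>a\<in>A. \<Sum>b\<in>B. h a b * R a b m m') =
      (\<Sum>a\<in>A. \<Sum>m\<in>M. \<Sum>m'\<in>M'. \<Sum>b\<in>B. h a b * R a b m m')"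
    by (rule sum_swap3)
  also have "\<dots> = (\<Sum>a\<in>A. \<Sum>b\<in>B. \<Sum>m\<in>M. \<Sum>m'\<in>M'. h a b * R a b m m')"
    by (intro sum.cong refl sum_swap3)
  finally show ?thesis by (simp only: sum_distrib_left)
qed

text \<open>The function \<open>s\<close> treats all bonds at once: \<open>s = 1\<close> inside the
  chain and \<open>s = letter_sign\<close> on the twisted bond from the last site to the
  first.\<close>

lemma bond_term:
  fixes f :: "3 list \<Rightarrow> real" and s :: "3 \<Rightarrow> real" and B :: "3 \<Rightarrow> complex^3^3"
  assumes i: "i < length c" "k < length c" "i \<noteq> k" and s: "\<And>u. s u * s u = 1"
    and B: "\<And>a u m. B a $ u $ m = of_real (s u * s m) * spin_matrix a $ u $ m"
  defines "\<psi> \<equiv> (\<lambda>w. complex_of_real (f w))"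
  shows "(\<Sum>a\<in>UNIV. of_real (coupling_J x a) *
        ((site_op (spin_matrix a) (Suc i) \<circ> site_op (B a) (Suc k)) \<psi> c
          + 2 * (site_op (spin_matrix a) (Suc i) ^^ 2) \<psi> c))
     - (\<Sum>a\<in>UNIV. \<Sum>b\<in>UNIV. of_real (coupling_A x a b) *
        (site_op (spin_matrix a) (Suc i) \<circ> site_op (spin_matrix b) (Suc i) \<circ>
          site_op (B a) (Suc k) \<circ> site_op (B b) (Suc k)) \<psi> c) =
    of_real (\<Sum>m\<in>UNIV. \<Sum>m'\<in>UNIV.
      s (c ! k) * s m' * real_kernel x (c ! i) (c ! k) m m' * f (c[i := m, k := m']))"
proof -
  let ?u = "c ! i" and ?v = "c ! k"
  let ?\<psi> = "\<lambda>m m'. \<psi> (c[i := m, k := m'])"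
  have prod: "(spin_matrix a ** spin_matrix b) $ u $ m = spin_product a b u m" for a b u m
    by (simp add: matrix_matrix_mult_def spin_product_def)
  have twisted: "(B a ** B b) $ u $ m = of_real (s u * s m) * spin_product a b u m" for a b u m
  proof -
    have "of_real (s u * s p) * X * (of_real (s p * s m) * Y) = of_real (s u * s m) * (X * Y :: complex)" for p X Y
    proof -
      have "of_real (s u * s p) * X * (of_real (s p * s m) * Y) =
          of_real (s u * s m * (s p * s p)) * (X * Y)" by (simp add: ac_simps)
      then show ?thesis by (simp add: s)
    qed
    then show ?thesis
      by (simp only: matrix_matrix_mult_def spin_product_def vec_lambda_beta B sum_distrib_left)
  qed
  \<comment> \<open>The one-site square is written as a two-site sum: only \<open>m' = c ! k\<close>
    survives, and its twist factor is \<open>s ?v * s ?v = 1\<close>.\<close>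
  have sq: "(site_op (spin_matrix a) (Suc i) ^^ 2) \<psi> c =
      (\<Sum>m\<in>UNIV. \<Sum>m'\<in>UNIV. of_real (s ?v * s m') * (if ?v = m' then spin_product a a ?u m else 0) * ?\<psi> m m')" for a
  proof -
    have "(site_op (spin_matrix a) (Suc i) ^^ 2) \<psi> c = (\<Sum>m\<in>UNIV. spin_product a a ?u m * \<psi> (c[i := m]))"
      using site_op_comp[OF i(1), of "spin_matrix a" "spin_matrix a" \<psi>]
      by (simp add: numeral_2_eq_2 site_op_def[of "_ ** _"] prod)
    moreover have "c[i := m, k := ?v] = c[i := m]" for m
      using i(3) by (metis list_update_id nth_list_update_neq)
    moreover have "of_real (s ?v * s m') * (if ?v = m' then X else 0) * \<psi> (c[i := m, k := m']) =
        (if ?v = m' then X * \<psi> (c[i := m, k := ?v]) else 0)" for m m' X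
      using s[of ?v] by (auto simp flip: of_real_mult)
    ultimately show ?thesis by simp
  qed
  have J: "(site_op (spin_matrix a) (Suc i) \<circ> site_op (B a) (Suc k)) \<psi> c =
      (\<Sum>m\<in>UNIV. \<Sum>m'\<in>UNIV. of_real (s ?v * s m') * (spin_matrix a $ ?u $ m * spin_matrix a $ ?v $ m') * ?\<psi> m m')" for a
    using site_op_pair[OF i] by (simp add: B ac_simps)
  have A: "(site_op (spin_matrix a) (Suc i) \<circ> site_op (spin_matrix b) (Suc i) \<circ>
          site_op (B a) (Suc k) \<circ> site_op (B b) (Suc k)) \<psi> c =
      (\<Sum>m\<in>UNIV. \<Sum>m'\<in>UNIV. of_real (s ?v * s m') * (spin_product a b ?u m * spin_product a b ?v m') * ?\<psi> m m')" for a b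
    using site_op_quadruple[OF i] by (simp add: prod twisted ac_simps)
  have "(\<Sum>a\<in>UNIV. of_real (coupling_J x a) *
        ((site_op (spin_matrix a) (Suc i) \<circ> site_op (B a) (Suc k)) \<psi> c
          + 2 * (site_op (spin_matrix a) (Suc i) ^^ 2) \<psi> c))
     - (\<Sum>a\<in>UNIV. \<Sum>b\<in>UNIV. of_real (coupling_A x a b) *
        (site_op (spin_matrix a) (Suc i) \<circ> site_op (spin_matrix b) (Suc i) \<circ>
          site_op (B a) (Suc k) \<circ> site_op (B b) (Suc k)) \<psi> c) =
     (\<Sum>m\<in>UNIV. \<Sum>m'\<in>UNIV. of_real (s ?v * s m') * spin_kernel x ?u ?v m m' * ?\<psi> m m')"
    unfolding J A sq sum_bilinear sum_biquadratic sum_subtractf [symmetric]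
    by (intro sum.cong refl)
      (simp add: spin_kernel_def sum_distrib_left sum_distrib_right sum.distrib sum_subtractf algebra_simps)
  then show ?thesis
    unfolding spin_kernel_eq \<psi>_def by simp
qed

text \<open>Since \<open>f\<close> is rotation-invariant, the term of the bond at site
  \<open>Suc i\<close> is the first-bond operator conjugated by \<open>rot ^^ i\<close>, applied to
  \<open>f\<close>; words of the wrong length give zero on both sides.\<close>

lemma hamiltonian_of_cyclic:
  assumes f: "cyclic N f" and N: "N \<ge> 2"
  shows "hamiltonian N x (\<lambda>w. complex_of_real (f w)) c = of_real (cyc_sum N (bond_op (real_kernel x) f) c)"
proof (cases "length c = N")
  case False
  let ?\<psi> = "\<lambda>w. complex_of_real (f w)"
  have site: "site_op A j \<psi> d = 0" if "\<And>d. length d \<noteq> N \<Longrightarrow> \<psi> d = 0" "length d \<noteq> N" for A j \<psi> d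
    using that by (simp add: site_op_def)
  have spin: "spin_op N a j \<psi> d = 0" if "\<And>d. length d \<noteq> N \<Longrightarrow> \<psi> d = 0" "length d \<noteq> N" for a j \<psi> d
    using that by (simp add: spin_op_def site)
  have f0: "?\<psi> d = 0" if "length d \<noteq> N" for d
    using f that by (auto simp: cyclic_def neutral_def)
  have "neutral N (bond_op (real_kernel x) f)"
    by (rule neutral_bond_op)
      (use f bond_kernel_spin in \<open>auto simp: cyclic_def real_kernel_def split: if_splits\<close>)
  then have "neutral N (cyc_sum N (bond_op (real_kernel x) f))"
    using cyclic_cyc_sum N by (simp add: cyclic_def)
  then have "cyc_sum N (bond_op (real_kernel x) f) c = 0"
    using False by (simp add: neutral_0)
  moreover have "hamiltonian N x ?\<psi> c = 0"
    using False by (simp add: hamiltonian_def numeral_2_eq_2 spin f0)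
  ultimately show ?thesis by simp
next
  case True
  let ?\<psi> = "\<lambda>w. complex_of_real (f w)"
  let ?h = "\<lambda>j. (\<Sum>a\<in>UNIV. of_real (coupling_J x a) *
        ((spin_op N a j \<circ> spin_op N a (j + 1)) ?\<psi> c + 2 * (spin_op N a j ^^ 2) ?\<psi> c))
     - (\<Sum>a\<in>UNIV. \<Sum>b\<in>UNIV. of_real (coupling_A x a b) *
        (spin_op N a j \<circ> spin_op N b j \<circ> spin_op N a (j + 1) \<circ> spin_op N b (j + 1)) ?\<psi> c)"
  have "?h (Suc i) = of_real ((rot ^^ i) (bond_op (real_kernel x) f) c)" if i: "i < N" for i
  proof (cases "Suc i < N")
    case True
    have op: "spin_op N a (Suc i) = site_op (spin_matrix a) (Suc i)"
      "spin_op N a (Suc i + 1) = site_op (spin_matrix a) (Suc (Suc i))" for a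
      using True by (simp_all add: spin_op_def fun_eq_iff)
    define X Y where "X = take i c" and "Y = drop (Suc (Suc i)) c"
    obtain u v where c: "c = X @ u # v # Y" and X: "length X = i"
    proof
      show "c = X @ c ! i # c ! Suc i # Y" "length X = i"
        using True \<open>length c = N\<close> by (simp_all add: X_def Y_def Cons_nth_drop_Suc)
    qed
    have N': "N = i + length Y + 2" using \<open>length c = N\<close> by (simp add: c X)
    have "?h (Suc i) = of_real (\<Sum>m\<in>UNIV. \<Sum>m'\<in>UNIV.
      1 * 1 * real_kernel x (c ! i) (c ! Suc i) m m' * f (c[i := m, Suc i := m']))"
      unfolding op by (rule bond_term) (use True \<open>length c = N\<close> in simp_all)
    also have "(\<Sum>m\<in>UNIV. \<Sum>m'\<in>UNIV.
      1 * 1 * real_kernel x (c ! i) (c ! Suc i) m m' * f (c[i := m, Suc i := m'])) =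
      (\<Sum>m\<in>UNIV. \<Sum>m'\<in>UNIV. real_kernel x u v m m' * f (X @ m # m' # Y))"
      by (simp add: c nth_append list_update_append flip: X)
    also have "\<dots> = (rot ^^ i) (bond_op (real_kernel x) f) c"
    proof -
      have "f (X @ m # m' # Y) = (- 1) ^ ((N + 1) * i) * word_sign X * f (m # m' # Y @ X)" for m m'
        using cyclic_append[OF f, of X "m # m' # Y"] by (simp add: X N')
      moreover have "(rot ^^ i) (bond_op (real_kernel x) f) c =
          (- 1) ^ ((N + 1) * i) * word_sign X * (\<Sum>m\<in>UNIV. \<Sum>m'\<in>UNIV. real_kernel x u v m m' * f (m # m' # Y @ X))"
        using rot_pow_append_eq[OF X, of "u # v # Y" N "bond_op (real_kernel x) f"] by (simp add: c N' X del: funpow.simps)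
      ultimately show ?thesis
        by (simp add: sum_distrib_left ac_simps)
    qed
    finally show ?thesis .
  next
    case False
    \<comment> \<open>The closing bond: the twist contributes
      \<open>letter_sign v * letter_sign m'\<close>, exactly the sign change when the first letter
      \<open>v\<close> is replaced by \<open>m'\<close> before the rotation.\<close>
    then have i': "Suc i = N" using i by simp
    let ?B = "\<lambda>a. \<chi> u m. twist a * spin_matrix a $ u $ m"
    have op: "spin_op N a (Suc i) = site_op (spin_matrix a) (Suc i)"
      "spin_op N a (Suc i + 1) = site_op (?B a) (Suc 0)" for a
      using spin_op_twisted[of N a] i' by (simp_all add: spin_op_def fun_eq_iff)
    obtain u v Y where c: "c = v # Y @ [u]" and Y: "length Y + 2 = N"
    proof -
      obtain v Z where 1: "c = v # Z" using \<open>length c = N\<close> N by (cases c) auto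
      then obtain Y u where "Z = Y @ [u]" using \<open>length c = N\<close> N by (cases Z rule: rev_cases) auto
      then show thesis using that 1 \<open>length c = N\<close> by simp
    qed
    have ln: "N = length Y + 2" "i = length Y + 1" using Y i' by simp_all
    have nth: "c ! i = u" "c ! 0 = v" "c[i := m, 0 := m'] = m' # Y @ [m]" for m m'
      using i' by (simp_all add: c nth_append list_update_append flip: Y)
    have "?h (Suc i) = of_real (\<Sum>m\<in>UNIV. \<Sum>m'\<in>UNIV.
      letter_sign (c ! 0) * letter_sign m' * real_kernel x (c ! i) (c ! 0) m m' * f (c[i := m, 0 := m']))"
      unfolding op by (rule bond_term) (use i' N \<open>length c = N\<close> in \<open>simp_all add: twisted_spin_matrix\<close>)
    also have "(\<Sum>m\<in>UNIV. \<Sum>m'\<in>UNIV.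
      letter_sign (c ! 0) * letter_sign m' * real_kernel x (c ! i) (c ! 0) m m' * f (c[i := m, 0 := m'])) =
      (\<Sum>m\<in>UNIV. \<Sum>m'\<in>UNIV. letter_sign v * letter_sign m' * real_kernel x u v m m' * f (m' # Y @ [m]))"
      unfolding nth ..
    also have "\<dots> = (rot ^^ i) (bond_op (real_kernel x) f) c"
    proof -
      have "f (m' # Y @ [m]) = (- 1) ^ ((N + 1) * i) * (letter_sign m' * word_sign Y) * f (m # m' # Y)" for m m'
        using cyclic_append[OF f, of "m' # Y" "[m]"] by (simp add: ln)
      moreover have "(rot ^^ i) (bond_op (real_kernel x) f) c =
          (- 1) ^ ((N + 1) * i) * (letter_sign v * word_sign Y) * (\<Sum>m\<in>UNIV. \<Sum>m'\<in>UNIV. real_kernel x u v m m' * f (m # m' # Y))"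
        using rot_pow_append_eq[of "v # Y" i "[u]" N "bond_op (real_kernel x) f"] by (simp add: c ln del: funpow.simps)
      ultimately show ?thesis
        by (simp add: sum_distrib_left ac_simps)
    qed
    finally show ?thesis .
  qed
  then have "(\<Sum>i<N. ?h (Suc i)) = of_real (cyc_sum N (bond_op (real_kernel x) f) c)"
    by (simp add: cyc_sum_def)
  moreover have "hamiltonian N x ?\<psi> c = (\<Sum>j=1..N. ?h j)"
    by (simp only: hamiltonian_def)
  ultimately show ?thesis
    using sum.atLeast1_atMost_eq[of ?h N] by simp
qed

section \<open>The magnetisation and spin-reversal sector, and the conclusion\<close>

lemma magnetisation_of_neutral:
  assumes "neutral N f"
  shows "magnetisation N (\<lambda>w. complex_of_real (f w)) = (\<lambda>c. 0)"
proof
  fix c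
  let ?\<psi> = "\<lambda>w. complex_of_real (f w)"
  have "spin_op N 3 j ?\<psi> c = of_int (spin (c ! (j - 1))) * ?\<psi> c" if "j \<in> {1..N}" for j
    using that by (simp add: spin_op_def site_op_def if_distrib[of "\<lambda>z. z * _"] cong: if_cong)
  then have "magnetisation N ?\<psi> c = of_int (\<Sum>j=1..N. spin (c ! (j - 1))) * ?\<psi> c"
    by (simp add: magnetisation_def sum_distrib_right)
  also have "(\<Sum>j=1..N. spin (c ! (j - 1))) = word_spin c" if "length c = N"
    using that sum.atLeast1_atMost_eq[of "\<lambda>j. spin (c ! (j - 1))" N]
    by (simp add: word_spin_def sum_list_sum_nth atLeast0LessThan)
  then have "of_int (\<Sum>j=1..N. spin (c ! (j - 1))) * ?\<psi> c = 0"
    using neutral_0[OF assms, of c] by (cases "length c = N \<and> word_spin c = 0") auto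
  finally show "magnetisation N ?\<psi> c = 0" .
qed

text \<open>\<open>flip_matrix\<close> is the permutation matrix of \<open>flip_letter\<close>, so
  its tensor power permutes words.\<close>

lemma spin_reversal_of_real:
  assumes "neutral N f"
  shows "spin_reversal N (\<lambda>w. complex_of_real (f w)) = (\<lambda>c. of_real (flip f c))"
proof
  fix c
  let ?\<psi> = "\<lambda>w. complex_of_real (f w)"
  show "spin_reversal N ?\<psi> c = of_real (flip f c)"
  proof (cases "length c = N")
    case True
    have flip_matrix: "flip_matrix $ u $ v = of_bool (v = flip_letter u)" for u v
      using exhaust_3[of u] exhaust_3[of v] by (elim disjE) (simp_all add: flip_matrix_def vector_3)
    have "(\<Prod>i<N. flip_matrix $ (c ! i) $ (d ! i)) = of_bool (d = map flip_letter c)" if d: "length d = N" for d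
    proof (cases "d = map flip_letter c")
      case False
      then obtain i where "i < N" "d ! i \<noteq> flip_letter (c ! i)"
        using True d by (auto simp: list_eq_iff_nth_eq)
      then have "(\<Prod>i<N. flip_matrix $ (c ! i) $ (d ! i)) = 0"
        by (intro prod_zero) (auto simp: flip_matrix)
      then show ?thesis using False by simp
    qed (use True in \<open>simp add: flip_matrix\<close>)
    then have "spin_reversal N ?\<psi> c = (\<Sum>d\<in>words N. of_bool (d = map flip_letter c) * ?\<psi> d)"
      using True by (simp add: spin_reversal_def tensor_power_op_def words_def)
    also have "\<dots> = (\<Sum>d\<in>words N. if d = map flip_letter c then ?\<psi> d else 0)"
      by (intro sum.cong) auto
    also have "\<dots> = of_real (flip f c)"
      using True by (simp add: words_def flip_def finite_words[unfolded words_def])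
    finally show ?thesis .
  next
    case False
    then show ?thesis
      using assms by (auto simp: spin_reversal_def tensor_power_op_def flip_def neutral_def)
  qed
qed

theorem theorem2p2:
  fixes N :: nat and x :: real
  assumes "N \<ge> 2"
  shows "\<exists>\<phi> \<in> tensor_space N. \<phi> \<noteq> (\<lambda>c. 0) \<and>
           hamiltonian N x \<phi> = (\<lambda>c. 0) \<and>
           magnetisation N \<phi> = (\<lambda>c. 0) \<and>
           spin_reversal N \<phi> = \<phi>"
proof -
  \<comment> \<open>The parameter \<open>- x / 2\<close> is the one built into
    \<open>real_kernel\<close>.\<close>
  obtain f where f: "cyclic N f" "f \<noteq> (\<lambda>w. 0)" "flip f = f"
    and split: "cyc_sum (N + 1) (split_first (- x / 2) f) = (\<lambda>w. 0)"
    and merge: "cyc_sum (N - 1) (merge_first (- x / 2) f) = (\<lambda>w. 0)"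
    using supersymmetry_singlet[OF assms] by blast
  have nf: "neutral N f" using f(1) by (simp add: cyclic_def)
  have "cyc_sum N (bond_op (real_kernel x) f) = (\<lambda>w. 0)"
    unfolding cyc_sum_real_kernel[OF f(1) assms]
    by (rule bond_sum_zero[OF f(1) assms split merge neutral_bond_op[OF nf bond_kernel_spin]])
  then have "hamiltonian N x (\<lambda>w. complex_of_real (f w)) = (\<lambda>c. 0)"
    by (simp add: fun_eq_iff hamiltonian_of_cyclic[OF f(1) assms])
  then show ?thesis
    using f nf magnetisation_of_neutral[OF nf] spin_reversal_of_real[OF nf]
    by (intro bexI[of _ "\<lambda>w. complex_of_real (f w)"])
      (auto simp: fun_eq_iff tensor_space_def neutral_def)
qed

end
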